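(* Let $X_N=\{\mathbf{x}_1,\dots,\mathbf{x}_N\}\subseteq\mathbb{S}^2$ be a set of $N\ge2$ distinct points with separation distance $q_{X_N}$, and suppose $s\ge 0$. If the truncation level is chosen as $L:=\lceil 55/q_{X_N}\rceil$, then the truncated discrepancy matrix $\mathbf{K}_s^L$ of $X_N$ is symmetric positive definite. Furthermore, its smallest eigenvalue satisfies $\lambda_1\ge a_L^{(s)}/(32\pi)$, and its condition number is bounded above by $$\mathrm{cond}(\mathbf{K}_s^L)\le\frac{32\pi^2}{q_{X_N}^2}\,\frac{\sum_{\ell=1}^L(2\ell+1)a_\ell^{(s)}}{a_L^{(s)}}.$$
   Context: $\mathbb{S}^2$ is the unit sphere in $\mathbb{R}^3$, $\mathrm{dist}(\mathbf{x},\mathbf{y})=\arccos\langle\mathbf{x},\mathbf{y}\rangle$, and $q_{X_N}:=\min_{i\ne j}\mathrm{dist}(\mathbf{x}_i,\mathbf{x}_j)$. $P_\ell$ is the Legendre polynomial of degree $\ell$ normalized by $P_\ell(1)=1$. For $s\ge0$ put $a_\ell^{(s)}:=(\ell+\tfrac12)^{-2s}$ and, for $L\ge1$, $$K_s^L(\mathbf{x},\mathbf{y}):=\sum_{\ell=1}^L\frac{2\ell+1}{4\pi}a_\ell^{(s)}P_\ell(\langle\mathbf{x},\mathbf{y}\rangle).$$ The truncated discrepancy matrix is $\mathbf{K}_s^L:=[K_s^L(\mathbf{x}_i,\mathbf{x}_j)]_{i,j=1}^N$. The condition number of a symmetric positive definite matrix is the ratio of its largest to its smallest eigenvalue. *)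

theory Defs
  imports
    "HOL-Analysis.Analysis"
    "HOL-Computational_Algebra.Polynomial"
    "Jordan_Normal_Form.Spectral_Radius"
begin

text \<open>
  Legendre polynomials in the normalization \<open>P\<^sub>l(1) = 1\<close>, given by Bonnet's three-term recurrence
  \<open>(l + 2) P\<^sub>l\<^sub>+\<^sub>2 = (2 l + 3) X P\<^sub>l\<^sub>+\<^sub>1 - (l + 1) P\<^sub>l\<close>.
\<close>

fun legendre :: "nat \<Rightarrow> real poly" where
  "legendre 0 = 1"
| "legendre (Suc 0) = [:0, 1:]"
| "legendre (Suc (Suc l)) =
     Polynomial.smult (1 / real (l + 2))
       (Polynomial.smult (real (2 * l + 3)) ([:0, 1:] * legendre (Suc l)) - Polynomial.smult (real (l + 1)) (legendre l))"

lemma poly_legendre_1: "poly (legendre l) 1 = 1"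
  by (induction l rule: legendre.induct) (simp_all add: field_simps)

lemma degree_legendre: "degree (legendre l) = l"
proof (induction l rule: legendre.induct)
  case (3 l)
  have nz: "legendre (Suc l) \<noteq> 0"
    using poly_legendre_1[of "Suc l"] by auto
  have d: "degree (Polynomial.smult (real (2 * l + 3)) ([:0, 1:] * legendre (Suc l))) = Suc (Suc l)"
    using "3.IH" nz by (simp add: degree_mult_eq)
  have "degree (Polynomial.smult (real (l + 1)) (legendre l)) < Suc (Suc l)"
    using "3.IH" by simp
  then have "degree (Polynomial.smult (real (2 * l + 3)) ([:0, 1:] * legendre (Suc l)) +
      - Polynomial.smult (real (l + 1)) (legendre l)) = Suc (Suc l)"
    using d by (subst degree_add_eq_left) (simp_all only: degree_minus)
  then show ?case
    by (simp only: legendre.simps degree_smult_eq diff_conv_add_uminus) simp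
qed simp_all

text \<open>Points of the unit sphere are indexed by \<open>0, \<dots>, N - 1\<close>, matching the indexing of matrices.\<close>

definition geodesic_dist :: "real ^ 3 \<Rightarrow> real ^ 3 \<Rightarrow> real" where
  "geodesic_dist x y = arccos (inner x y)"

definition separation_dist :: "nat \<Rightarrow> (nat \<Rightarrow> real ^ 3) \<Rightarrow> real" where
  "separation_dist N x = Min {geodesic_dist (x i) (x j) | i j. i < N \<and> j < N \<and> i \<noteq> j}"

definition sobolev_coeff :: "real \<Rightarrow> nat \<Rightarrow> real" where
  "sobolev_coeff s l = (real l + 1 / 2) powr (- 2 * s)"

definition trunc_kernel :: "real \<Rightarrow> nat \<Rightarrow> real ^ 3 \<Rightarrow> real ^ 3 \<Rightarrow> real" where
  "trunc_kernel s L x y =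
     (\<Sum>l = 1..L. (2 * real l + 1) / (4 * pi) * sobolev_coeff s l * poly (legendre l) (inner x y))"

definition discrepancy_matrix :: "real \<Rightarrow> nat \<Rightarrow> nat \<Rightarrow> (nat \<Rightarrow> real ^ 3) \<Rightarrow> real mat" where
  "discrepancy_matrix s L N x = mat N N (\<lambda>(i, j). trunc_kernel s L (x i) (x j))"

definition sym_pos_def :: "real mat \<Rightarrow> bool" where
  "sym_pos_def A \<longleftrightarrow>
     square_mat A \<and> transpose_mat A = A \<and>
     (\<forall>v \<in> carrier_vec (dim_row A). v \<noteq> 0\<^sub>v (dim_row A) \<longrightarrow> 0 < scalar_prod v (A *\<^sub>v v))"

text \<open>
  For a symmetric matrix of positive dimension the real spectrum is finite, nonempty and contains
  all eigenvalues; the following notions are only meaningful in that case.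
\<close>

definition min_eigenvalue :: "real mat \<Rightarrow> real" where
  "min_eigenvalue A = Min (spectrum A)"

definition max_eigenvalue :: "real mat \<Rightarrow> real" where
  "max_eigenvalue A = Max (spectrum A)"

definition condition_number :: "real mat \<Rightarrow> real" where
  "condition_number A = max_eigenvalue A / min_eigenvalue A"

end

theory Submission
  imports Defs
begin

text \<open>
  Each kernel \<open>P\<^sub>l(\<langle>x, y\<rangle>)\<close> is a positive multiple of the Fischer product of two zonal harmonics, hence positive
  semidefinite. As the coefficients decrease, the quadratic form of the matrix is at least \<open>a\<^sub>L / (4 \<pi>)\<close> times
  that of \<open>\<Sum>\<^sub>l (2 l + 1) P\<^sub>l\<close>. The latter is bounded below by comparison with the square of a Fejer kernel of
  order \<open>n \<approx> L / 2\<close>, a nonnegative polynomial with value \<open>n\<^sup>4\<close> on the diagonal, mean at most \<open>2 n\<^sup>2\<close> and decay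
  \<open>16 |x - y|\<^sup>-\<^sup>4\<close>: packing arguments make its matrix diagonally dominant. The largest eigenvalue is at most \<open>N\<close>
  times the diagonal entry.
\<close>

section \<open>Positive definiteness of the Legendre kernels\<close>

text \<open>Positivity of the Legendre kernels comes from algebra on coefficients, without
  integration over the sphere. The Fejer kernel is squared for its decay: one factor only decays
  like \<open>|x - y|^-2\<close>, while packing balls in space allows on the order of
  \<open>R^3\<close> points within distance \<open>R\<close>, so an exponent above 3 is wanted. The
  obstacle is that the kernel starts at degree 1, whereas a nonzero nonnegative comparison
  polynomial has positive mean and hence a degree 0 part. That part costs a multiple of
  \<open>n^2 N\<close>, and \<open>N\<close> is at most a multiple of \<open>r^-2\<close> if
  \<open>2 r\<close> is a lower bound for the Euclidean separation. Against the diagonal value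
  \<open>n^4\<close> this is affordable once \<open>n r\<close> exceeds a constant. The argument
  uses \<open>n r \<ge> 8\<close> with \<open>r = q / pi\<close> and \<open>2 n > L\<close>, which
  amounts to \<open>2 n q \<ge> 16 pi\<close>, about 50.3; this is where 55 enters.\<close>

text \<open>
  A polynomial in three variables is represented by its coefficient function on exponent vectors
  \<open>m :: 3 \<Rightarrow> nat\<close>; finite support is never needed, since only coefficients of a fixed degree are paired.
\<close>

definition var_mult :: "3 \<Rightarrow> ((3 \<Rightarrow> nat) \<Rightarrow> real) \<Rightarrow> (3 \<Rightarrow> nat) \<Rightarrow> real" where
  "var_mult a f m = (if m a = 0 then 0 else f (m(a := m a - 1)))"

definition var_deriv :: "3 \<Rightarrow> ((3 \<Rightarrow> nat) \<Rightarrow> real) \<Rightarrow> (3 \<Rightarrow> nat) \<Rightarrow> real" where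
  "var_deriv a f m = real (Suc (m a)) * f (m(a := Suc (m a)))"

lemma var_deriv_commute: "var_deriv a (var_deriv b f) = var_deriv b (var_deriv a f)"
  by (rule ext) (auto simp: var_deriv_def fun_upd_twist)

text \<open>The canonical commutation relation between partial derivatives and coordinate
  multiplications; all commutators of the composite operators below are computed from it.\<close>

lemma var_deriv_var_mult: "var_deriv a (var_mult b f) = (\<lambda>m. var_mult b (var_deriv a f) m + of_bool (a = b) * f m)"
proof (cases "a = b")
  case True
  show ?thesis
  proof
    fix m show "var_deriv a (var_mult b f) m = var_mult b (var_deriv a f) m + of_bool (a = b) * f m"
      using True by (cases "m b") (auto simp: var_deriv_def var_mult_def algebra_simps fun_upd_idem)
  qed
next
  case False
  then show ?thesis
    by (intro ext) (auto simp: var_deriv_def var_mult_def fun_upd_twist)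
qed

lemma var_mult_var_deriv: "var_mult a (var_deriv a f) m = real (m a) * f m"
  by (cases "m a") (auto simp: var_deriv_def var_mult_def fun_upd_idem)

lemma var_mult_add: "var_mult a (\<lambda>m. f m + g m) = (\<lambda>m. var_mult a f m + var_mult a g m)"
  and var_mult_diff: "var_mult a (\<lambda>m. f m - g m) = (\<lambda>m. var_mult a f m - var_mult a g m)"
  and var_mult_scale: "var_mult a (\<lambda>m. c * f m) = (\<lambda>m. c * var_mult a f m)"
  by (auto simp: var_mult_def)

lemma var_deriv_add: "var_deriv a (\<lambda>m. f m + g m) = (\<lambda>m. var_deriv a f m + var_deriv a g m)"
  and var_deriv_diff: "var_deriv a (\<lambda>m. f m - g m) = (\<lambda>m. var_deriv a f m - var_deriv a g m)"
  and var_deriv_scale: "var_deriv a (\<lambda>m. c * f m) = (\<lambda>m. c * var_deriv a f m)"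
  by (auto simp: var_deriv_def algebra_simps)

lemmas var_linear = var_mult_add var_mult_diff var_mult_scale var_deriv_add var_deriv_diff var_deriv_scale

section \<open>Linear forms, directional derivatives and the Laplacian\<close>

definition lin_mult :: "real ^ 3 \<Rightarrow> ((3 \<Rightarrow> nat) \<Rightarrow> real) \<Rightarrow> (3 \<Rightarrow> nat) \<Rightarrow> real" where
  "lin_mult z f m = z $ 1 * var_mult 1 f m + z $ 2 * var_mult 2 f m + z $ 3 * var_mult 3 f m"

definition dir_deriv :: "real ^ 3 \<Rightarrow> ((3 \<Rightarrow> nat) \<Rightarrow> real) \<Rightarrow> (3 \<Rightarrow> nat) \<Rightarrow> real" where
  "dir_deriv z f m = z $ 1 * var_deriv 1 f m + z $ 2 * var_deriv 2 f m + z $ 3 * var_deriv 3 f m"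

definition norm2_mult :: "((3 \<Rightarrow> nat) \<Rightarrow> real) \<Rightarrow> (3 \<Rightarrow> nat) \<Rightarrow> real" where
  "norm2_mult f m = var_mult 1 (var_mult 1 f) m + var_mult 2 (var_mult 2 f) m + var_mult 3 (var_mult 3 f) m"

definition laplacian :: "((3 \<Rightarrow> nat) \<Rightarrow> real) \<Rightarrow> (3 \<Rightarrow> nat) \<Rightarrow> real" where
  "laplacian f m = var_deriv 1 (var_deriv 1 f) m + var_deriv 2 (var_deriv 2 f) m + var_deriv 3 (var_deriv 3 f) m"

abbreviation mdeg :: "(3 \<Rightarrow> nat) \<Rightarrow> nat" where
  "mdeg m \<equiv> m 1 + m 2 + m 3"

lemmas op_defs = lin_mult_def[abs_def] dir_deriv_def[abs_def] norm2_mult_def[abs_def] laplacian_def[abs_def]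

lemma distinct_3 [simp]: "(1::3) \<noteq> 2" "(2::3) \<noteq> 1" "(1::3) \<noteq> 3" "(3::3) \<noteq> 1" "(2::3) \<noteq> 3" "(3::3) \<noteq> 2"
  by (simp_all add: bit1.of_nat_eq[symmetric])

lemma dir_deriv_lin_mult: "dir_deriv y (lin_mult z f) m = lin_mult z (dir_deriv y f) m + inner y z * f m"
  by (simp add: op_defs var_linear var_deriv_var_mult inner_vec_def sum_3) (simp add: algebra_simps)

lemma dir_deriv_norm2_mult: "dir_deriv y (norm2_mult f) m = norm2_mult (dir_deriv y f) m + 2 * lin_mult y f m"
  by (simp add: op_defs var_linear var_deriv_var_mult) (simp add: algebra_simps)

lemma laplacian_lin_mult: "laplacian (lin_mult z f) m = lin_mult z (laplacian f) m + 2 * dir_deriv z f m"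
  by (simp add: op_defs var_linear var_deriv_var_mult) (simp add: algebra_simps)

text \<open>Commuting the Laplacian past \<open>|x|^2\<close> leaves four times the Euler operator
  plus twice the dimension. The Euler operator is diagonal on monomials with eigenvalue
  \<open>mdeg m\<close>, and the 6 is \<open>2 * 3\<close>.\<close>

lemma laplacian_norm2_mult: "laplacian (norm2_mult f) m = norm2_mult (laplacian f) m + (4 * real (mdeg m) + 6) * f m"
  using var_mult_var_deriv[of 1 f m] var_mult_var_deriv[of 2 f m] var_mult_var_deriv[of 3 f m]
  by (simp add: op_defs var_linear var_deriv_var_mult) (simp add: algebra_simps)

lemma laplacian_dir_deriv: "laplacian (dir_deriv y f) = dir_deriv y (laplacian f)"
  by (rule ext, simp add: op_defs var_linear)
    (simp add: algebra_simps var_deriv_commute[of 2 1] var_deriv_commute[of 3 1] var_deriv_commute[of 3 2])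

lemma mdeg_Suc: "mdeg (m(a := Suc (m a))) = Suc (mdeg m)"
  using exhaust_3[of a] by auto

lemma dir_deriv_linear: "dir_deriv z (\<lambda>m. c * f m - d * g m) = (\<lambda>m. c * dir_deriv z f m - d * dir_deriv z g m)"
  and laplacian_linear: "laplacian (\<lambda>m. c * f m - d * g m) = (\<lambda>m. c * laplacian f m - d * laplacian g m)"
  by (rule ext, simp add: op_defs var_linear, simp add: algebra_simps)+

text \<open>
  The homogeneous harmonic polynomial \<open>|x|\<^sup>l P\<^sub>l(\<langle>z, x\<rangle> / |x|)\<close> for a unit vector \<open>z\<close>: Bonnet's recurrence,
  homogenized in \<open>x\<close>.
\<close>

fun zonal :: "real ^ 3 \<Rightarrow> nat \<Rightarrow> (3 \<Rightarrow> nat) \<Rightarrow> real" where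
  "zonal z 0 = (\<lambda>m. of_bool (m = (\<lambda>_. 0)))"
| "zonal z (Suc 0) = lin_mult z (zonal z 0)"
| "zonal z (Suc (Suc l)) =
     (\<lambda>m. real (2 * l + 3) / real (l + 2) * lin_mult z (zonal z (Suc l)) m
        - real (l + 1) / real (l + 2) * norm2_mult (zonal z l) m)"

lemma dir_deriv_zonal_0: "dir_deriv y (zonal z 0) m = 0"
  by (auto simp: dir_deriv_def var_deriv_def fun_eq_iff)

lemma lin_mult_zero [simp]: "lin_mult z (\<lambda>_. 0) = (\<lambda>_. 0)"
  and norm2_mult_zero [simp]: "norm2_mult (\<lambda>_. 0) = (\<lambda>_. 0)"
  and dir_deriv_zero [simp]: "dir_deriv z (\<lambda>_. 0) = (\<lambda>_. 0)"
  by (auto simp: op_defs var_mult_def var_deriv_def)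

lemma lin_mult_scale: "lin_mult z (\<lambda>m. c * f m) = (\<lambda>m. c * lin_mult z f m)"
  and norm2_mult_scale: "norm2_mult (\<lambda>m. c * f m) = (\<lambda>m. c * norm2_mult f m)"
  by (rule ext, simp add: op_defs var_linear, simp add: algebra_simps)+

lemma zonal_scaled:
  "real (l + 2) * (real (2 * l + 3) / real (l + 2) * X - real (l + 1) / real (l + 2) * Y)
     = real (2 * l + 3) * X - real (l + 1) * Y"
  by (simp add: right_diff_distrib)

text \<open>Differentiating along the axis lowers the degree. The derivative of the recurrence
  produces the terms of the recurrence one degree lower, which recombine into
  \<open>(l + 2)^2\<close> times \<open>zonal z (Suc l)\<close>. The lemma supplies the derivative
  term in the proof of harmonicity.\<close>

lemma dir_deriv_zonal:
  assumes z: "inner z z = 1"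
  shows "dir_deriv z (zonal z l) = (\<lambda>m. real l * zonal z (l - 1) m)"
proof (induction l rule: legendre.induct)
  case 1
  show ?case by (rule ext) (simp add: dir_deriv_zonal_0 del: zonal.simps)
next
  case 2
  have "dir_deriv z (zonal z 0) = (\<lambda>_. 0)" by (rule ext) (rule dir_deriv_zonal_0)
  then show ?case unfolding zonal.simps(2) by (intro ext) (simp add: dir_deriv_lin_mult z del: zonal.simps)
next
  case (3 l)
  show ?case
  proof
    fix m
    have a: "real (l + 2) * dir_deriv z (zonal z (Suc (Suc l))) m =
       real (2 * l + 3) * dir_deriv z (lin_mult z (zonal z (Suc l))) m - real (l + 1) * dir_deriv z (norm2_mult (zonal z l)) m"
      unfolding zonal.simps(3) dir_deriv_linear by (rule zonal_scaled)
    have b: "dir_deriv z (lin_mult z (zonal z (Suc l))) m = real (l + 1) * lin_mult z (zonal z l) m + zonal z (Suc l) m"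
      unfolding dir_deriv_lin_mult 3 z by (simp add: lin_mult_scale del: zonal.simps)
    have c: "dir_deriv z (norm2_mult (zonal z l)) m = real l * norm2_mult (zonal z (l - 1)) m + 2 * lin_mult z (zonal z l) m"
      unfolding dir_deriv_norm2_mult 3 by (simp add: norm2_mult_scale del: zonal.simps)
    \<comment> \<open>Bonnet's recurrence one degree down. For \<open>l = 0\<close> the truncated
      \<open>l - 1\<close> is harmless because its term carries the factor
      \<open>real l\<close>.\<close>
    have d: "real (l + 1) * zonal z (Suc l) m =
         real (2 * l + 1) * lin_mult z (zonal z l) m - real l * norm2_mult (zonal z (l - 1)) m"
    proof (cases l)
      case (Suc k)
      have "real (k + 2) * zonal z (Suc (Suc k)) m = real (2 * k + 3) * lin_mult z (zonal z (Suc k)) m - real (k + 1) * norm2_mult (zonal z k) m"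
        unfolding zonal.simps(3) by (rule zonal_scaled)
      then show ?thesis unfolding Suc by (simp add: algebra_simps del: zonal.simps)
    qed (simp del: zonal.simps(1))
    define P Q R where "P = zonal z (Suc l) m" and "Q = lin_mult z (zonal z l) m" and "R = norm2_mult (zonal z (l - 1)) m"
    have "real (l + 2) * dir_deriv z (zonal z (Suc (Suc l))) m
      = real (2 * l + 3) * P + real (l + 1) * (real (2 * l + 1) * Q - real l * R)"
      unfolding a b c P_def[symmetric] Q_def[symmetric] R_def[symmetric] by (simp add: algebra_simps)
    also have "\<dots> = real (l + 2) * (real (l + 2) * P)"
      unfolding P_def Q_def R_def d[symmetric] by (simp add: algebra_simps del: zonal.simps)
    finally have "dir_deriv z (zonal z (Suc (Suc l))) m = real (l + 2) * P"
      using mult_left_cancel[of "real (l + 2)"] by simp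
    then show "dir_deriv z (zonal z (Suc (Suc l))) m = real (Suc (Suc l)) * zonal z (Suc (Suc l) - 1) m"
      by (simp add: P_def del: zonal.simps)
  qed
qed

lemma var_mult_support:
  assumes "\<And>m. mdeg m \<noteq> k \<Longrightarrow> f m = 0" and "mdeg m \<noteq> Suc k"
  shows "var_mult a f m = 0"
proof (cases "m a = 0")
  case False
  then have "mdeg m = Suc (mdeg (m(a := m a - 1)))"
    using mdeg_Suc[of "m(a := m a - 1)" a] by (simp add: fun_upd_idem)
  then have "f (m(a := m a - 1)) = 0"
    using assms by simp
  then show ?thesis by (simp add: var_mult_def)
qed (simp add: var_mult_def)

text \<open>Homogeneity, in terms of coefficients. It lets \<open>mdeg m\<close> be replaced by
  \<open>l\<close> when the Laplacian meets \<open>norm2_mult (zonal z l)\<close>.\<close>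

lemma zonal_support: "mdeg m \<noteq> l \<Longrightarrow> zonal z l m = 0"
proof (induction l arbitrary: m rule: legendre.induct)
  case 1
  then show ?case by auto
next
  case 2
  have "zonal z 0 m = 0" if "mdeg m \<noteq> 0" for m
    using that by auto
  then have "var_mult a (zonal z 0) m = 0" for a
    using 2 by (intro var_mult_support[of 0]) (auto simp del: zonal.simps)
  then show ?case by (simp add: lin_mult_def del: zonal.simps(1))
next
  case (3 l)
  have "var_mult a (zonal z (Suc l)) m = 0" for a
    by (rule var_mult_support[of "Suc l"]) (use 3 in blast)+
  moreover have "var_mult a (var_mult a (zonal z l)) m = 0" for a
    by (rule var_mult_support[of "Suc l"], rule var_mult_support[of l]) (use 3 in blast)+
  ultimately show ?case by (simp add: norm2_mult_def lin_mult_def del: zonal.simps(1,2))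
qed

text \<open>By induction only the commutator terms remain: \<open>(2 l + 3) * 2 (l + 1)\<close> from
  the linear factor and \<open>(l + 1) * (4 l + 6)\<close> from \<open>|x|^2\<close>, and these
  cancel.\<close>

lemma laplacian_zonal:
  assumes z: "inner z z = 1"
  shows "laplacian (zonal z l) = (\<lambda>_. 0)"
proof (induction l rule: legendre.induct)
  case 1
  show ?case by (auto simp: laplacian_def var_deriv_def fun_eq_iff)
next
  case 2
  have "laplacian (zonal z 0) = (\<lambda>_. 0)" by (auto simp: laplacian_def var_deriv_def fun_eq_iff)
  then show ?case unfolding zonal.simps(2) by (intro ext) (simp add: laplacian_lin_mult dir_deriv_zonal_0 del: zonal.simps)
next
  case (3 l)
  show ?case
  proof
    fix m
    have "real (l + 2) * laplacian (zonal z (Suc (Suc l))) m =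
       real (2 * l + 3) * laplacian (lin_mult z (zonal z (Suc l))) m - real (l + 1) * laplacian (norm2_mult (zonal z l)) m"
      unfolding zonal.simps(3) laplacian_linear by (rule zonal_scaled)
    moreover have "laplacian (lin_mult z (zonal z (Suc l))) m = 2 * (real (l + 1) * zonal z l m)"
      unfolding laplacian_lin_mult 3 dir_deriv_zonal[OF z] by (simp del: zonal.simps)
    moreover have "laplacian (norm2_mult (zonal z l)) m = (4 * real l + 6) * zonal z l m"
      unfolding laplacian_norm2_mult 3
      using zonal_support[of m l z] by (cases "mdeg m = l") (auto simp del: zonal.simps)
    ultimately have "real (l + 2) * laplacian (zonal z (Suc (Suc l))) m = 0"
      by (simp add: algebra_simps del: zonal.simps)
    then show "laplacian (zonal z (Suc (Suc l))) m = 0" by (simp del: zonal.simps)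
  qed
qed

section \<open>The Fischer product and evaluation of forms\<close>

definition monomials :: "nat \<Rightarrow> (3 \<Rightarrow> nat) set" where
  "monomials l = {m. mdeg m = l}"

lemma finite_monomials: "finite (monomials l)"
proof (rule finite_subset)
  show "monomials l \<subseteq> (\<Pi>\<^sub>E a\<in>UNIV. {..l})"
  proof
    fix m assume "m \<in> monomials l"
    then have "m a \<le> l" for a using exhaust_3[of a] by (auto simp: monomials_def)
    then show "m \<in> (\<Pi>\<^sub>E a\<in>UNIV. {..l})" by (auto simp: PiE_def extensional_def)
  qed
qed (auto intro!: finite_PiE)

text \<open>Raising the exponent of \<open>a\<close> is a bijection onto the monomials that contain
  \<open>a\<close>. The two arguments of \<open>G\<close> are the lowered and the raised exponent
  vector, so one reindexing serves both \<open>fischer\<close> and \<open>form_at\<close>.\<close>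

lemma sum_monomials_Suc:
  "(\<Sum>m\<in>monomials (Suc l). if m a = 0 then 0 else G (m(a := m a - 1)) m) =
   (\<Sum>m\<in>monomials l. (G m (m(a := Suc (m a))) :: real))"
proof -
  have "(\<Sum>m\<in>monomials (Suc l). if m a = 0 then 0 else G (m(a := m a - 1)) m) =
      (\<Sum>m | m \<in> monomials (Suc l) \<and> m a \<noteq> 0. G (m(a := m a - 1)) m)"
    by (intro sum.mono_neutral_cong_right) (auto simp: finite_monomials)
  also have "\<dots> = (\<Sum>m\<in>monomials l. G m (m(a := Suc (m a))))"
  proof (rule sum.reindex_bij_witness[of _ "\<lambda>m. m(a := Suc (m a))" "\<lambda>m. m(a := m a - 1)"])
    fix m assume m: "m \<in> {m \<in> monomials (Suc l). m a \<noteq> 0}"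
    then show "m(a := m a - 1) \<in> monomials l"
      using mdeg_Suc[of "m(a := m a - 1)" a] by (simp add: monomials_def)
  next
    fix m assume "m \<in> monomials l"
    then show "m(a := Suc (m a)) \<in> {m \<in> monomials (Suc l). m a \<noteq> 0}"
      using mdeg_Suc[of m a] by (simp add: monomials_def)
  qed (simp_all add: fun_upd_idem)
  finally show ?thesis .
qed

definition multi_fact :: "(3 \<Rightarrow> nat) \<Rightarrow> real" where
  "multi_fact m = (\<Prod>a\<in>UNIV. fact (m a))"

definition monomial_at :: "real ^ 3 \<Rightarrow> (3 \<Rightarrow> nat) \<Rightarrow> real" where
  "monomial_at y m = (\<Prod>a\<in>UNIV. y $ a ^ m a)"

lemma multi_fact_Suc: "multi_fact (m(a := Suc (m a))) = real (Suc (m a)) * multi_fact m"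
proof -
  have "multi_fact n = fact (n a) * (\<Prod>b\<in>UNIV - {a}. fact (n b))" for n
    unfolding multi_fact_def by (rule prod.remove) auto
  then show ?thesis by (simp add: algebra_simps)
qed

lemma monomial_at_Suc: "monomial_at y (m(a := Suc (m a))) = y $ a * monomial_at y m"
proof -
  have "monomial_at y n = y $ a ^ n a * (\<Prod>b\<in>UNIV - {a}. y $ b ^ n b)" for n
    unfolding monomial_at_def by (rule prod.remove) auto
  then show ?thesis by simp
qed

text \<open>For forms of degree \<open>l\<close> this is the constant obtained by applying
  \<open>f\<close>, read as a differential operator, to \<open>g\<close>. The weights
  \<open>multi_fact m\<close> are what makes multiplication by a variable adjoint to its
  derivative.\<close>

definition fischer :: "nat \<Rightarrow> ((3 \<Rightarrow> nat) \<Rightarrow> real) \<Rightarrow> ((3 \<Rightarrow> nat) \<Rightarrow> real) \<Rightarrow> real" where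
  "fischer l f g = (\<Sum>m\<in>monomials l. multi_fact m * f m * g m)"

definition form_at :: "nat \<Rightarrow> ((3 \<Rightarrow> nat) \<Rightarrow> real) \<Rightarrow> real ^ 3 \<Rightarrow> real" where
  "form_at l f y = (\<Sum>m\<in>monomials l. f m * monomial_at y m)"

lemma fischer_var_mult: "fischer (Suc l) (var_mult a f) g = fischer l f (var_deriv a g)"
proof -
  have "fischer (Suc l) (var_mult a f) g =
      (\<Sum>m\<in>monomials (Suc l). if m a = 0 then 0 else multi_fact m * f (m(a := m a - 1)) * g m)"
    unfolding fischer_def by (intro sum.cong) (auto simp: var_mult_def)
  also have "\<dots> = fischer l f (var_deriv a g)"
    unfolding fischer_def using sum_monomials_Suc[where G = "\<lambda>n m. multi_fact m * f n * g m"]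
    by (simp add: multi_fact_Suc var_deriv_def algebra_simps del: of_nat_Suc)
  finally show ?thesis .
qed

lemma form_at_var_mult: "form_at (Suc l) (var_mult a f) y = y $ a * form_at l f y"
proof -
  have "form_at (Suc l) (var_mult a f) y =
      (\<Sum>m\<in>monomials (Suc l). if m a = 0 then 0 else f (m(a := m a - 1)) * monomial_at y m)"
    unfolding form_at_def by (intro sum.cong) (auto simp: var_mult_def)
  also have "\<dots> = y $ a * form_at l f y"
    unfolding form_at_def using sum_monomials_Suc[where G = "\<lambda>n m. f n * monomial_at y m"]
    by (simp add: monomial_at_Suc sum_distrib_left algebra_simps)
  finally show ?thesis .
qed

lemma fischer_linear:
  "fischer l (\<lambda>m. f m + g m) h = fischer l f h + fischer l g h"
  "fischer l (\<lambda>m. f m - g m) h = fischer l f h - fischer l g h"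
  "fischer l (\<lambda>m. c * f m) h = c * fischer l f h"
  "fischer l h (\<lambda>m. f m + g m) = fischer l h f + fischer l h g"
  "fischer l h (\<lambda>m. c * f m) = c * fischer l h f"
  by (simp_all add: fischer_def algebra_simps sum.distrib sum_subtractf sum_distrib_left)

lemma form_at_linear:
  "form_at l (\<lambda>m. f m + g m) y = form_at l f y + form_at l g y"
  "form_at l (\<lambda>m. f m - g m) y = form_at l f y - form_at l g y"
  "form_at l (\<lambda>m. c * f m) y = c * form_at l f y"
  by (simp_all add: form_at_def algebra_simps sum.distrib sum_subtractf sum_distrib_left)

lemma fischer_lin_mult: "fischer (Suc l) (lin_mult y f) g = fischer l f (dir_deriv y g)"
  by (simp add: op_defs fischer_linear fischer_var_mult)

lemma fischer_norm2_mult: "fischer (Suc (Suc l)) (norm2_mult f) g = fischer l f (laplacian g)"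
  by (simp add: op_defs fischer_linear fischer_var_mult)

lemma form_at_lin_mult: "form_at (Suc l) (lin_mult z f) y = inner z y * form_at l f y"
  by (simp add: op_defs form_at_linear form_at_var_mult inner_vec_def sum_3 algebra_simps)

lemma form_at_norm2_mult: "form_at (Suc (Suc l)) (norm2_mult f) y = inner y y * form_at l f y"
  by (simp add: op_defs form_at_linear form_at_var_mult inner_vec_def sum_3 algebra_simps)

text \<open>Euler's identity for homogeneous functions: evaluation at \<open>y\<close> turns the
  factor \<open>y $ a\<close> into multiplication by the variable, and the exponents of a monomial
  add up to the degree.\<close>

lemma form_at_dir_deriv: "form_at l (dir_deriv y g) y = real (Suc l) * form_at (Suc l) g y"
proof -
  have "form_at l (dir_deriv y g) y = form_at (Suc l) (\<lambda>m. var_mult 1 (var_deriv 1 g) m + var_mult 2 (var_deriv 2 g) m + var_mult 3 (var_deriv 3 g) m) y"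
    by (simp add: op_defs form_at_linear form_at_var_mult)
  also have "\<dots> = real (Suc l) * form_at (Suc l) g y"
    unfolding form_at_def sum_distrib_left
  proof (rule sum.cong)
    fix m assume "m \<in> monomials (Suc l)"
    then have m: "real (Suc l) = real (m 1) + real (m 2) + real (m 3)"
      by (auto simp: monomials_def)
    show "(var_mult 1 (var_deriv 1 g) m + var_mult 2 (var_deriv 2 g) m + var_mult 3 (var_deriv 3 g) m) * monomial_at y m =
        real (Suc l) * (g m * monomial_at y m)"
      unfolding var_mult_var_deriv m by (simp add: algebra_simps)
  qed simp
  finally show ?thesis .
qed

lemma form_at_0: "form_at 0 f y = f (\<lambda>_. 0)" and fischer_0: "fischer 0 f g = f (\<lambda>_. 0) * g (\<lambda>_. 0)"
proof -
  have "monomials 0 = {\<lambda>_. 0}"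
  proof (auto simp: monomials_def fun_eq_iff)
    fix m :: "3 \<Rightarrow> nat" and a :: 3 assume "m 1 = 0" "m 2 = 0" "m 3 = 0"
    then show "m a = 0" using exhaust_3[of a] by auto
  qed
  then show "form_at 0 f y = f (\<lambda>_. 0)" "fischer 0 f g = f (\<lambda>_. 0) * g (\<lambda>_. 0)"
    by (simp_all add: form_at_def fischer_def monomial_at_def multi_fact_def)
qed

lemma form_at_zonal:
  assumes y: "inner y y = 1"
  shows "form_at l (zonal z l) y = poly (legendre l) (inner z y)"
proof (induction l rule: legendre.induct)
  case (3 l)
  then show ?case
    unfolding zonal.simps(3) form_at_linear form_at_lin_mult form_at_norm2_mult y by (simp add: diff_divide_distrib del: zonal.simps)
qed (simp_all add: form_at_lin_mult form_at_0)

text \<open>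
  Multiplication by a linear form is adjoint to a directional derivative, and multiplication by
  \<open>|x|\<^sup>2\<close> to the Laplacian, so against a harmonic \<open>g\<close> only the leading term of the recurrence survives.
\<close>

lemma fischer_zonal:
  assumes y: "inner y y = 1"
  shows "laplacian g = (\<lambda>_. 0) \<Longrightarrow> fischer l (zonal y l) g = (\<Prod>k<l. real (2 * k + 1)) * form_at l g y"
proof (induction l arbitrary: g rule: legendre.induct)
  case 1
  then show ?case by (simp add: fischer_0 form_at_0)
next
  case 2
  then show ?case using form_at_dir_deriv[of 0 y g]
    by (simp add: fischer_lin_mult fischer_0 form_at_0)
next
  case (3 l)
  have "laplacian (dir_deriv y g) = (\<lambda>_. 0)" by (simp add: laplacian_dir_deriv 3)
  then have "fischer (Suc l) (zonal y (Suc l)) (dir_deriv y g) =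
      (\<Prod>k<Suc l. real (2 * k + 1)) * (real (l + 2) * form_at (Suc (Suc l)) g y)"
    using 3 by (simp add: form_at_dir_deriv del: zonal.simps)
  moreover have "fischer l (zonal y l) (laplacian g) = 0" by (simp add: 3 fischer_def)
  \<comment> \<open>The leading coefficient \<open>(2 l + 3) / (l + 2)\<close> meets the factor
    \<open>l + 2\<close> of Euler's identity; what is left is the next odd factor of the
    product.\<close>
  ultimately show ?case
    unfolding zonal.simps(3) fischer_linear fischer_lin_mult fischer_norm2_mult
    by (simp add: field_simps del: zonal.simps)
qed

lemma legendre_psd:
  fixes x :: "nat \<Rightarrow> real ^ 3"
  assumes "\<And>i. i \<in> I \<Longrightarrow> inner (x i) (x i) = 1"
  shows "(\<Sum>i\<in>I. \<Sum>j\<in>I. v i * v j * poly (legendre l) (inner (x i) (x j))) \<ge> 0"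
proof -
  define c where "c = (\<Prod>k<l. real (2 * k + 1))"
  have c: "c > 0" unfolding c_def by (intro prod_pos) auto
  have "c * (\<Sum>i\<in>I. \<Sum>j\<in>I. v i * v j * poly (legendre l) (inner (x i) (x j)))
      = (\<Sum>i\<in>I. \<Sum>j\<in>I. v i * v j * fischer l (zonal (x i) l) (zonal (x j) l))"
    unfolding sum_distrib_left
    by (intro sum.cong refl)
      (simp add: fischer_zonal laplacian_zonal form_at_zonal assms c_def inner_commute mult_ac)
  also have "\<dots> = (\<Sum>i\<in>I. \<Sum>j\<in>I. \<Sum>m\<in>monomials l. multi_fact m * ((v i * zonal (x i) l m) * (v j * zonal (x j) l m)))"
    unfolding fischer_def sum_distrib_left by (intro sum.cong refl) (simp add: mult_ac)
  also have "\<dots> = (\<Sum>i\<in>I. \<Sum>m\<in>monomials l. \<Sum>j\<in>I. multi_fact m * ((v i * zonal (x i) l m) * (v j * zonal (x j) l m)))"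
    by (intro sum.cong refl sum.swap)
  also have "\<dots> = (\<Sum>m\<in>monomials l. \<Sum>i\<in>I. \<Sum>j\<in>I. multi_fact m * ((v i * zonal (x i) l m) * (v j * zonal (x j) l m)))"
    by (rule sum.swap)
  also have "\<dots> = (\<Sum>m\<in>monomials l. multi_fact m * (\<Sum>i\<in>I. v i * zonal (x i) l m)\<^sup>2)"
    unfolding power2_eq_square sum_product by (simp add: sum_distrib_left)
  also have "\<dots> \<ge> 0"
    by (intro sum_nonneg mult_nonneg_nonneg) (auto simp: multi_fact_def intro!: prod_nonneg)
  finally show ?thesis using c by (simp add: zero_le_mult_iff)
qed

text \<open>Two unit vectors with inner product \<open>u\<close> give a positive semidefinite matrix
  with diagonal 1 and off-diagonal entry \<open>P\<^sub>l(u)\<close>; testing it on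
  \<open>(1, 1)\<close> and \<open>(1, -1)\<close> gives both bounds.\<close>

lemma abs_legendre_le_1:
  assumes "\<bar>u\<bar> \<le> 1"
  shows "\<bar>poly (legendre l) u\<bar> \<le> 1"
proof -
  define x :: "nat \<Rightarrow> real ^ 3" where
    "x i = (if i = 0 then vector [1, 0, 0] else vector [u, sqrt (1 - u\<^sup>2), 0])" for i
  have u: "u\<^sup>2 \<le> 1" using assms by (simp add: abs_square_le_1)
  then have x: "inner (x i) (x i) = 1" for i
    by (auto simp: x_def inner_vec_def sum_3 power2_eq_square[symmetric])
  have x01: "inner (x 0) (x 1) = u" "inner (x 1) (x 0) = u" by (auto simp: x_def inner_vec_def sum_3)
  define v :: "real \<Rightarrow> nat \<Rightarrow> real" where "v t i = (if i = 0 then 1 else t)" for t i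
  have "0 \<le> (\<Sum>i\<in>{0,1}. \<Sum>j\<in>{0,1}. v t i * v t j * poly (legendre l) (inner (x i) (x j)))" for t
    by (rule legendre_psd) (rule x)
  then have "0 \<le> 1 + t * poly (legendre l) u + (t * poly (legendre l) u + t * t)" for t
    unfolding sum.insert_if sum.empty by (simp add: x x01[simplified] poly_legendre_1) (simp add: v_def mult_ac)
  from this[of 1] this[of "-1"] show ?thesis by (simp add: abs_le_iff)
qed

section \<open>Legendre expansions\<close>

lemma legendre_rec:
  "real (l + 2) * poly (legendre (Suc (Suc l))) u =
     real (2 * l + 3) * (u * poly (legendre (Suc l)) u) - real (l + 1) * poly (legendre l) u"
  by (simp add: field_simps)

lemma pderiv_legendre_rec:
  "real (l + 2) * poly (pderiv (legendre (Suc (Suc l)))) u =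
     real (2 * l + 3) * (poly (legendre (Suc l)) u + u * poly (pderiv (legendre (Suc l))) u)
     - real (l + 1) * poly (pderiv (legendre l)) u"
  by (simp add: pderiv_smult pderiv_diff pderiv_mult pderiv_pCons) (simp add: field_simps)

text \<open>The two identities are proved together because the induction step for each one uses the
  second identity at the previous index.\<close>

lemma pderiv_legendre_aux:
  fixes u :: real
  defines "P \<equiv> \<lambda>l. poly (legendre l) u" and "D \<equiv> \<lambda>l. poly (pderiv (legendre l)) u"
  shows "D (Suc l) = u * D l + real (l + 1) * P l \<and> u * D (Suc l) - D l = real (l + 1) * P (Suc l)"
proof (induction l)
  case 0
  show ?case by (simp add: P_def D_def pderiv_pCons)
next
  case (Suc l)
  define n where "n = real l"
  have n: "n \<ge> 0" by (simp add: n_def)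
  have 1: "(n + 2) * P (Suc (Suc l)) = (2 * n + 3) * (u * P (Suc l)) - (n + 1) * P l"
    using legendre_rec[of l u] by (simp add: P_def n_def algebra_simps del: legendre.simps)
  have 2: "(n + 2) * D (Suc (Suc l)) = (2 * n + 3) * (P (Suc l) + u * D (Suc l)) - (n + 1) * D l"
    using pderiv_legendre_rec[of l u] by (simp add: P_def D_def n_def algebra_simps del: legendre.simps)
  have 3: "D (Suc l) = u * D l + (n + 1) * P l" "D l = u * D (Suc l) - (n + 1) * P (Suc l)"
    using Suc by (auto simp: n_def algebra_simps)
  have "(n + 2) * D (Suc (Suc l)) = (n + 2) * (u * D (Suc l) + (n + 2) * P (Suc l))"
    unfolding 2 by (subst 3(2)) (simp add: algebra_simps)
  then have a: "D (Suc (Suc l)) = u * D (Suc l) + (n + 2) * P (Suc l)"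
    using n mult_left_cancel[of "n + 2"] by auto
  have b: "u * D (Suc (Suc l)) - D (Suc l) = (n + 2) * P (Suc (Suc l))"
  proof -
    have *: "u * (u * d1 + (n + 2) * p1) - d1 = (2 * n + 3) * (u * p1) - (n + 1) * p0"
      if "d1 = u * d0 + (n + 1) * p0" "d0 = u * d1 - (n + 1) * p1" for d1 d0 p1 p0
    proof -
      have "u * d0 = u * (u * d1 - (n + 1) * p1)"
        using that(2) by (rule arg_cong)
      with that(1) have "u * (u * d1) - d1 = (n + 1) * (u * p1) - (n + 1) * p0"
        by (simp add: right_diff_distrib mult.left_commute)
      then show ?thesis by (simp add: algebra_simps)
    qed
    show ?thesis unfolding a 1 by (rule *[OF 3])
  qed
  show ?case using a b by (simp add: n_def algebra_simps)
qed

lemma pderiv_legendre_diff: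
  "poly (pderiv (legendre (Suc (Suc l)))) u - poly (pderiv (legendre l)) u = real (2 * l + 3) * poly (legendre (Suc l)) u"
proof -
  have "poly (pderiv (legendre (Suc (Suc l)))) u - poly (pderiv (legendre l)) u =
      real (Suc l + 1) * poly (legendre (Suc l)) u + real (l + 1) * poly (legendre (Suc l)) u"
    using pderiv_legendre_aux[of l u] pderiv_legendre_aux[of "Suc l" u] by linarith
  then show ?thesis by (simp add: algebra_simps del: legendre.simps)
qed

lemma poly_legendre_m1: "poly (legendre l) (-1) = (-1) ^ l"
  by (induction l rule: legendre.induct) (simp_all add: field_simps)

section \<open>Orthogonality and Legendre coefficients\<close>

definition sym_integral :: "real poly \<Rightarrow> real" where
  "sym_integral p = integral {-1..1} (poly p)"

lemma poly_integrable: "(poly p :: real \<Rightarrow> real) integrable_on {a..b}"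
  by (intro integrable_continuous_interval continuous_intros)

lemma sym_integral_linear:
  "sym_integral (p + q) = sym_integral p + sym_integral q" "sym_integral (p - q) = sym_integral p - sym_integral q" "sym_integral (Polynomial.smult c p) = c * sym_integral p"
  by (simp_all add: sym_integral_def Henstock_Kurzweil_Integration.integral_add Henstock_Kurzweil_Integration.integral_diff poly_integrable poly_add[abs_def] poly_diff[abs_def] poly_smult[abs_def])

lemma sym_integral_0: "sym_integral 0 = 0"
  using sym_integral_linear(3)[of 0 0] by simp

lemma sym_integral_sum: "sym_integral (\<Sum>i\<in>A. f i) = (\<Sum>i\<in>A. sym_integral (f i))"
proof (induction A rule: infinite_finite_induct)
  case (insert x F)
  then show ?case by (simp add: sym_integral_linear)
qed (simp_all add: sym_integral_0)

lemma sym_integral_mono: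
  assumes "\<And>u. \<bar>u\<bar> \<le> 1 \<Longrightarrow> poly p u \<le> poly q u"
  shows "sym_integral p \<le> sym_integral q"
  unfolding sym_integral_def by (intro integral_le poly_integrable assms) auto

lemma sym_integral_1: "sym_integral 1 = 2"
proof -
  have "poly (1 :: real poly) = (\<lambda>_. 1)" by (rule ext) simp
  then show ?thesis by (simp add: sym_integral_def)
qed

text \<open>Up to the factor \<open>2 l + 3\<close>, an antiderivative is the difference of the
  Legendre polynomials of degrees \<open>l + 2\<close> and \<open>l\<close>. It vanishes at 1 by the
  normalization and at -1 since the degrees have equal parity.\<close>

lemma sym_integral_legendre: "sym_integral (legendre (Suc l)) = 0"
proof -
  have "((\<lambda>u. poly (pderiv (legendre (Suc (Suc l)) - legendre l)) u) has_integral
      poly (legendre (Suc (Suc l)) - legendre l) 1 - poly (legendre (Suc (Suc l)) - legendre l) (-1)) {-1..1}"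
    by (intro fundamental_theorem_of_calculus)
      (simp, simp only: has_real_derivative_iff_has_vector_derivative[symmetric] has_field_derivative_at_within[OF poly_DERIV])
  moreover have "poly (pderiv (legendre (Suc (Suc l)) - legendre l)) = poly (Polynomial.smult (real (2 * l + 3)) (legendre (Suc l)))"
    by (rule ext) (simp only: pderiv_diff poly_diff pderiv_legendre_diff poly_smult)
  ultimately have "sym_integral (Polynomial.smult (real (2 * l + 3)) (legendre (Suc l))) = 0"
    unfolding sym_integral_def by (simp add: poly_legendre_1 poly_legendre_m1 integral_unique del: legendre.simps poly_smult)
  then show ?thesis by (simp add: sym_integral_linear del: legendre.simps)
qed

lemma legendre_X:
  "Polynomial.smult (real (2 * l + 3)) ([:0, 1:] * legendre (Suc l)) =
     Polynomial.smult (real (l + 2)) (legendre (Suc (Suc l))) + Polynomial.smult (real (l + 1)) (legendre l)"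
  unfolding legendre.simps(3) by simp

text \<open>Bonnet's recurrence read as a rule for multiplication by \<open>X\<close>. Since
  \<open>X\<close> may be attached to either factor of a product, applying the rule to each of them
  relates integrals of different index pairs.\<close>

lemma sym_integral_X:
  "real (2 * l + 3) * sym_integral (q * ([:0, 1:] * legendre (Suc l))) =
     real (l + 2) * sym_integral (q * legendre (Suc (Suc l))) + real (l + 1) * sym_integral (q * legendre l)"
  using arg_cong[OF legendre_X[of l], of "\<lambda>p. sym_integral (q * p)"]
  unfolding mult_smult_right distrib_left sym_integral_linear .

text \<open>Induction on the smaller index, starting from mean zero. In the step \<open>X\<close> is
  moved from the smaller to the larger index \<open>l\<close>, which yields \<open>l + 1\<close> and
  \<open>l - 1\<close>; both still exceed \<open>Suc k\<close>, so the hypothesis applies.\<close>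

lemma legendre_orthogonal: "k < l \<Longrightarrow> sym_integral (legendre k * legendre l) = 0"
proof (induction k arbitrary: l rule: legendre.induct)
  case 1
  then obtain m where "l = Suc m" by (cases l) auto
  then show ?case by (simp add: sym_integral_legendre del: legendre.simps(3))
next
  case 2
  define m where "m = l - 2"
  have l: "l = Suc (Suc m)" using 2 by (simp add: m_def)
  have "real (2 * Suc m + 3) * sym_integral (1 * ([:0, 1:] * legendre (Suc (Suc m)))) = 0"
    unfolding sym_integral_X by (simp add: sym_integral_legendre del: legendre.simps)
  then show ?case by (simp add: l del: legendre.simps(3))
next
  case (3 k)
  define m where "m = l - 1"
  have l: "l = Suc m" and m: "Suc k < m" using 3(3) by (simp_all add: m_def)
  have "real (2 * m + 3) * sym_integral (legendre (Suc k) * ([:0, 1:] * legendre (Suc m))) = 0"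
    unfolding sym_integral_X using 3(1)[of "Suc (Suc m)"] 3(1)[of m] m by (simp del: legendre.simps)
  then have a: "sym_integral (legendre (Suc m) * ([:0, 1:] * legendre (Suc k))) = 0"
    by (simp add: mult_ac del: legendre.simps)
  have "real (k + 2) * sym_integral (legendre (Suc m) * legendre (Suc (Suc k))) = 0"
    using sym_integral_X[of k "legendre (Suc m)"] a 3(2)[of "Suc m"] m by (simp add: mult.commute[of "legendre k"] del: legendre.simps)
  then show ?case unfolding l by (simp add: mult.commute del: legendre.simps)
qed

lemma legendre_orthogonal': "k \<noteq> l \<Longrightarrow> sym_integral (legendre k * legendre l) = 0"
  using legendre_orthogonal[of k l] legendre_orthogonal[of l k] by (cases k l rule: linorder_cases) (auto simp: mult.commute)

lemma legendre_norm: "real (2 * l + 1) * sym_integral (legendre l * legendre l) = 2"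
proof (induction l rule: legendre.induct)
  case 1
  show ?case by (simp add: sym_integral_1)
next
  case 2
  show ?case using sym_integral_X[of 0 1] sym_integral_legendre[of 1] by (simp add: sym_integral_1)
next
  case (3 l)
  have a: "real (2 * l + 3) * sym_integral (legendre (Suc (Suc l)) * ([:0, 1:] * legendre (Suc l)))
      = real (l + 2) * sym_integral (legendre (Suc (Suc l)) * legendre (Suc (Suc l)))"
    unfolding sym_integral_X by (subst legendre_orthogonal'[of "Suc (Suc l)" l]) simp_all
  have b: "real (2 * l + 5) * sym_integral (legendre (Suc l) * ([:0, 1:] * legendre (Suc (Suc l))))
      = real (l + 2) * sym_integral (legendre (Suc l) * legendre (Suc l))"
    using sym_integral_X[of "Suc l" "legendre (Suc l)"] legendre_orthogonal'[of "Suc l" "Suc (Suc (Suc l))"]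
    by (simp add: algebra_simps del: legendre.simps)
  \<comment> \<open>The integral \<open>A\<close> of \<open>X\<close> times two neighbouring
    Legendre polynomials is evaluated twice, with Bonnet's recurrence applied to either factor.
    Orthogonality leaves one squared norm each time, which links consecutive norms.\<close>
  define A where "A = sym_integral (legendre (Suc (Suc l)) * ([:0, 1:] * legendre (Suc l)))"
  have c: "sym_integral (legendre (Suc l) * ([:0, 1:] * legendre (Suc (Suc l)))) = A"
    unfolding A_def by (simp only: mult_ac)
  have "real (l + 2) * (real (2 * Suc (Suc l) + 1) * sym_integral (legendre (Suc (Suc l)) * legendre (Suc (Suc l))))
     = real (2 * l + 3) * (real (2 * l + 5) * A)"
    using a unfolding A_def by (simp add: algebra_simps del: legendre.simps)
  also have "\<dots> = real (l + 2) * (real (2 * Suc l + 1) * sym_integral (legendre (Suc l) * legendre (Suc l)))"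
    using b unfolding c by (simp add: algebra_simps del: legendre.simps)
  also have "\<dots> = real (l + 2) * 2"
    using 3 by simp
  finally show ?case by (rule mult_left_cancel[THEN iffD1, rotated]) simp
qed

lemma legendre_expansion:
  assumes "degree p \<le> L"
  shows "\<exists>b. p = (\<Sum>l\<le>L. Polynomial.smult (b l) (legendre l))"
  using assms
proof (induction L arbitrary: p)
  case 0
  then obtain c where "p = [:c:]" by (meson degree_0_id degree_eq_zeroE le_zero_eq)
  then show ?case by (intro exI[of _ "\<lambda>_. c"]) simp
next
  case (Suc L)
  define c where "c = coeff p (Suc L) / lead_coeff (legendre (Suc L))"
  have nz: "lead_coeff (legendre (Suc L)) \<noteq> 0"
    using poly_legendre_1[of "Suc L"] by auto
  define q where "q = p - Polynomial.smult c (legendre (Suc L))"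
  have "degree q \<le> Suc L"
    unfolding q_def using Suc.prems degree_legendre[of "Suc L"]
    by (intro degree_diff_le) (auto intro: order.trans[OF degree_smult_le])
  moreover have "coeff q (Suc L) = 0"
    using nz by (simp add: q_def c_def degree_legendre)
  ultimately have "degree q \<le> L"
    by (metis degree_0 le_SucE leading_coeff_0_iff zero_le)
  then obtain b where "q = (\<Sum>l\<le>L. Polynomial.smult (b l) (legendre l))"
    using Suc.IH by blast
  then have "p = (\<Sum>l\<le>Suc L. Polynomial.smult ((b(Suc L := c)) l) (legendre l))"
    by (simp add: q_def algebra_simps del: legendre.simps)
  then show ?case by blast
qed

lemma sym_integral_expansion:
  assumes "p = (\<Sum>l\<le>L. Polynomial.smult (b l) (legendre l))" and "k \<le> L"
  shows "real (2 * k + 1) * sym_integral (p * legendre k) = 2 * b k"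
proof -
  have "sym_integral (p * legendre k) = (\<Sum>l\<le>L. b l * sym_integral (legendre l * legendre k))"
    unfolding assms(1) sum_distrib_right sym_integral_sum by (simp add: sym_integral_linear)
  also have "\<dots> = (\<Sum>l\<le>L. if l = k then b k * sym_integral (legendre k * legendre k) else 0)"
    by (intro sum.cong) (auto simp: legendre_orthogonal')
  also have "\<dots> = b k * sym_integral (legendre k * legendre k)"
    using assms(2) by simp
  finally show ?thesis using legendre_norm[of k] by (simp add: algebra_simps)
qed

section \<open>Fejer kernels\<close>

text \<open>The recurrence is that of \<open>(1 - T\<^sub>n(u)) / (1 - u)\<close> with the Chebyshev polynomials \<open>T\<^sub>n\<close>.\<close>

fun fejer :: "nat \<Rightarrow> real poly" where
  "fejer 0 = 0"
| "fejer (Suc 0) = 1"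
| "fejer (Suc (Suc n)) = [:2:] + ([:0, 2:] * fejer (Suc n) - fejer n)"

lemma fejer_cos: "(1 - cos t) * poly (fejer n) (cos t) = 1 - cos (real n * t)"
proof (induction n rule: fejer.induct)
  case (3 n)
  have "cos (real (Suc (Suc n)) * t) = 2 * cos t * cos (real (Suc n) * t) - cos (real n * t)"
    using cos_times_cos[of t "real (Suc n) * t"] by (simp add: algebra_simps)
  moreover have "(1 - cos t) * poly (fejer (Suc (Suc n))) (cos t) =
     2 * (1 - cos t) + 2 * cos t * ((1 - cos t) * poly (fejer (Suc n)) (cos t))
       - (1 - cos t) * poly (fejer n) (cos t)"
    by (simp add: algebra_simps)
  ultimately show ?case unfolding 3 by (simp add: algebra_simps)
qed auto

lemma fejer_1: "poly (fejer n) 1 = (real n)\<^sup>2"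
  by (induction n rule: fejer.induct) (simp_all add: power2_eq_square algebra_simps)

lemma degree_fejer: "degree (fejer n) \<le> n - 1"
proof (induction n rule: fejer.induct)
  case (3 n)
  have "degree ([:0, 2:] * fejer (Suc n)) \<le> Suc n"
    using degree_mult_le[of "[:0, 2:]" "fejer (Suc n)"] 3 by simp
  moreover have "degree (fejer n) \<le> Suc n" using 3 by linarith
  ultimately have "degree ([:0, 2:] * fejer (Suc n) - fejer n) \<le> Suc n"
    by (rule degree_diff_le)
  then show ?case
    unfolding fejer.simps(3) by (intro degree_add_le) auto
qed auto

lemma abs_sin_mult_le: "\<bar>sin (real n * t)\<bar> \<le> real n * \<bar>sin t\<bar>"
proof (induction n)
  case (Suc n)
  have "\<bar>sin (real (Suc n) * t)\<bar> = \<bar>sin (real n * t) * cos t + cos (real n * t) * sin t\<bar>"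
    unfolding of_nat_Suc distrib_right sin_add by (simp add: algebra_simps sin_add)
  also have "\<dots> \<le> \<bar>sin (real n * t)\<bar> * \<bar>cos t\<bar> + \<bar>cos (real n * t)\<bar> * \<bar>sin t\<bar>"
    by (metis abs_mult abs_triangle_ineq)
  also have "\<dots> \<le> \<bar>sin (real n * t)\<bar> * 1 + 1 * \<bar>sin t\<bar>"
    by (intro add_mono mult_mono) auto
  finally show ?case using Suc by (simp add: algebra_simps)
qed auto

text \<open>With \<open>u = cos t\<close> and half angles the kernel is
  \<open>(sin (n t / 2) / sin (t / 2))^2\<close>, so the bound by \<open>n^2\<close> is
  \<open>abs_sin_mult_le\<close>. The point \<open>u = 1\<close>, where the quotient degenerates, is
  treated by \<open>fejer_1\<close>.\<close>

lemma fejer_bounds: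
  assumes "\<bar>u\<bar> \<le> 1"
  shows "0 \<le> poly (fejer n) u" "poly (fejer n) u \<le> (real n)\<^sup>2"
    and "(1 - u) * poly (fejer n) u \<le> 2"
proof -
  obtain t where u: "u = cos t" using assms cos_arccos_abs by metis
  show "(1 - u) * poly (fejer n) u \<le> 2"
    unfolding u fejer_cos using cos_ge_minus_one[of "real n * t"] by linarith
  have *: "0 \<le> poly (fejer n) u \<and> poly (fejer n) u \<le> (real n)\<^sup>2"
  proof (cases "u = 1")
    case True
    then show ?thesis by (simp add: fejer_1)
  next
    case False
    then have pos: "1 - cos t > 0" using u cos_le_one[of t] by (simp add: less_le)
    have c: "1 - cos s = 2 * (sin (s / 2))\<^sup>2" for s :: real
      using cos_double_sin[of "s / 2"] by simp
    have "(sin (real n * (t / 2)))\<^sup>2 \<le> (real n * \<bar>sin (t / 2)\<bar>)\<^sup>2"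
      using power_mono[OF abs_sin_mult_le[of n "t / 2"], of 2] by simp
    then have "1 - cos (real n * t) \<le> (1 - cos t) * (real n)\<^sup>2"
      unfolding c by (simp add: power_mult_distrib algebra_simps)
    then have "(1 - cos t) * poly (fejer n) u \<le> (1 - cos t) * (real n)\<^sup>2"
      unfolding u fejer_cos .
    moreover have "(1 - cos t) * 0 \<le> (1 - cos t) * poly (fejer n) u"
      unfolding u fejer_cos by simp
    ultimately show ?thesis using pos by (simp del: mult_zero_right) (simp add: zero_le_mult_iff)
  qed
  then show "0 \<le> poly (fejer n) u" "poly (fejer n) u \<le> (real n)\<^sup>2" by auto
qed

lemma integral_fejer_sq_le:
  assumes n: "n \<ge> 2"
  shows "integral {-1..1} (poly ((fejer n)\<^sup>2)) \<le> 4 * (real n)\<^sup>2"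
proof -
  define N where "N = (real n)\<^sup>2"
  have "4 \<le> N" unfolding N_def using power_mono[of 2 "real n" 2] n by simp
  \<comment> \<open>the two bounds \<open>2 / (1 - u)\<close> and \<open>N\<close> of \<open>fejer_bounds\<close> agree at \<open>c\<close>\<close>
  define c where "c = 1 - 2 / N"
  have c: "-1 \<le> c" "c < 1" using \<open>4 \<le> N\<close> by (auto simp: c_def field_simps)
  have "((\<lambda>u. 4 / (1 - u)) has_vector_derivative 4 / (1 - u)\<^sup>2) (at u within {-1..c})"
    if "u \<in> {-1..c}" for u
    using that c
    by (auto simp: has_real_derivative_iff_has_vector_derivative[symmetric] power2_eq_square
        intro!: derivative_eq_intros)
  then have I1: "((\<lambda>u. 4 / (1 - u)\<^sup>2) has_integral (4 / (1 - c) - 4 / (1 - (-1)))) {-1..c}"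
    by (intro fundamental_theorem_of_calculus) (use c in auto)
  have I2: "((\<lambda>u. N\<^sup>2) has_integral N\<^sup>2 * (1 - c)) {c..1}"
    using has_integral_const_real[of "N\<^sup>2" c 1] c by (simp add: mult.commute)
  have int: "poly ((fejer n)\<^sup>2) integrable_on {a..b}" for a b by (rule poly_integrable)
  have "integral {-1..c} (poly ((fejer n)\<^sup>2)) \<le> 4 / (1 - c) - 4 / (1 - (-1))"
  proof (rule has_integral_le[OF integrable_integral[OF int] I1])
    fix u assume u: "u \<in> {-1..c}"
    then have "\<bar>u\<bar> \<le> 1" "1 - u > 0" using c by auto
    then have "poly (fejer n) u \<le> 2 / (1 - u)" "0 \<le> poly (fejer n) u"
      using fejer_bounds[of u n] by (auto simp: field_simps)
    then have "(poly (fejer n) u)\<^sup>2 \<le> (2 / (1 - u))\<^sup>2" by (intro power_mono)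
    then show "poly ((fejer n)\<^sup>2) u \<le> 4 / (1 - u)\<^sup>2" by (simp add: power_divide)
  qed
  moreover have "integral {c..1} (poly ((fejer n)\<^sup>2)) \<le> N\<^sup>2 * (1 - c)"
  proof (rule has_integral_le[OF integrable_integral[OF int] I2])
    fix u assume u: "u \<in> {c..1}"
    then have "\<bar>u\<bar> \<le> 1" using c by auto
    then have "(poly (fejer n) u)\<^sup>2 \<le> N\<^sup>2"
      unfolding N_def by (intro power_mono fejer_bounds)
    then show "poly ((fejer n)\<^sup>2) u \<le> N\<^sup>2" by simp
  qed
  \<comment> \<open>By the choice of \<open>c\<close> the terms are \<open>2 * N\<close>,
    \<open>-2\<close> and \<open>2 * N\<close>.\<close>
  moreover have "4 / (1 - c) - 4 / (1 - (-1)) + N\<^sup>2 * (1 - c) \<le> 4 * N"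
    using \<open>4 \<le> N\<close> by (simp add: c_def power2_eq_square)
  moreover have "integral {-1..1} (poly ((fejer n)\<^sup>2)) =
     integral {-1..c} (poly ((fejer n)\<^sup>2)) + integral {c..1} (poly ((fejer n)\<^sup>2))"
    using Henstock_Kurzweil_Integration.integral_combine[OF _ _ int, of "-1" c 1] c by simp
  ultimately show ?thesis unfolding N_def by linarith
qed

section \<open>Packing estimates\<close>

lemma emeasure_ball_less_top: "emeasure lborel (ball (c :: 'a::euclidean_space) r) < top_class.top"
  using emeasure_lborel_ball_finite[of c r] by (simp only: infinity_ennreal_def)

text \<open>Open balls of radius \<open>r\<close> around points that are \<open>2 * r\<close> apart
  are disjoint, so their volumes add up inside \<open>S\<close>.\<close>

lemma packing_bound:
  fixes x :: "'b \<Rightarrow> 'a::euclidean_space"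
  assumes J: "finite J" and sep: "\<And>i j. i \<in> J \<Longrightarrow> j \<in> J \<Longrightarrow> i \<noteq> j \<Longrightarrow> 2 * r \<le> dist (x i) (x j)"
    and r: "0 \<le> r" and S: "S \<in> fmeasurable lborel" "\<And>j. j \<in> J \<Longrightarrow> ball (x j) r \<subseteq> S"
  shows "real (card J) * (unit_ball_vol (real DIM('a)) * r ^ DIM('a)) \<le> measure lborel S"
proof -
  have disj: "disjoint_family_on (\<lambda>j. ball (x j) r) J"
    unfolding disjoint_family_on_def
  proof (intro ballI impI equals0I)
    fix i j y assume ij: "i \<in> J" "j \<in> J" "i \<noteq> j" and y: "y \<in> ball (x i) r \<inter> ball (x j) r"
    have "dist (x i) (x j) \<le> dist (x i) y + dist (x j) y" by (rule dist_triangle2)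
    with y sep[OF ij] show False by simp
  qed
  have "real (card J) * (unit_ball_vol (real DIM('a)) * r ^ DIM('a)) = (\<Sum>j\<in>J. measure lborel (ball (x j) r))"
    using r by (simp add: content_ball)
  also have "\<dots> = measure lborel (\<Union>j\<in>J. ball (x j) r)"
    using J disj by (intro measure_finite_Union[symmetric]) (auto simp: emeasure_ball_less_top less_imp_neq)
  also have "\<dots> \<le> measure lborel S"
    using S by (intro measure_mono_fmeasurable) (auto intro!: borel_open)
  finally show ?thesis .
qed

lemma unit_ball_vol_3_cancel: "c * (unit_ball_vol 3 * a) \<le> unit_ball_vol 3 * b \<Longrightarrow> c * a \<le> b"
  using mult_le_cancel_left_pos[of "unit_ball_vol 3" "c * a" b] by (simp add: mult.left_commute)

lemma card_in_ball:
  fixes x :: "'b \<Rightarrow> real ^ 3"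
  assumes J: "finite J" and sep: "\<And>i j. i \<in> J \<Longrightarrow> j \<in> J \<Longrightarrow> i \<noteq> j \<Longrightarrow> 2 * r \<le> dist (x i) (x j)"
    and r: "0 < r" and R: "0 \<le> R" "\<And>j. j \<in> J \<Longrightarrow> dist y (x j) \<le> R"
  shows "real (card J) * r ^ 3 \<le> (R + r) ^ 3"
proof -
  have "real (card J) * (unit_ball_vol (real DIM(real ^ 3)) * r ^ DIM(real ^ 3)) \<le> measure lborel (ball y (R + r))"
  proof (rule packing_bound[OF J sep])
    show "ball (x j) r \<subseteq> ball y (R + r)" if "j \<in> J" for j
    proof
      fix w assume "w \<in> ball (x j) r"
      then show "w \<in> ball y (R + r)"
        using dist_triangle[of y w "x j"] R(2)[OF that] by simp
    qed
  qed (use r in \<open>auto intro!: fmeasurableI simp: emeasure_ball_less_top\<close>)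
  also have "\<dots> = unit_ball_vol (real DIM(real ^ 3)) * (R + r) ^ DIM(real ^ 3)"
    using r R by (simp add: content_ball)
  finally show ?thesis by - (rule unit_ball_vol_3_cancel, simp)
qed

text \<open>The balls lie in a shell of thickness \<open>2 * r\<close> around the sphere. Its volume
  is only of order \<open>r\<close>, which improves the count from order \<open>r^-3\<close> to
  order \<open>r^-2\<close>.\<close>

lemma card_on_sphere:
  fixes x :: "'b \<Rightarrow> real ^ 3"
  assumes J: "finite J" and sep: "\<And>i j. i \<in> J \<Longrightarrow> j \<in> J \<Longrightarrow> i \<noteq> j \<Longrightarrow> 2 * r \<le> dist (x i) (x j)"
    and r: "0 < r" "r \<le> 1" and sph: "\<And>j. j \<in> J \<Longrightarrow> norm (x j) = 1"
  shows "real (card J) \<le> 8 / r\<^sup>2"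
proof -
  define S where "S = ball (0 :: real ^ 3) (1 + r) - ball 0 (1 - r)"
  have "real (card J) * (unit_ball_vol (real DIM(real ^ 3)) * r ^ DIM(real ^ 3)) \<le> measure lborel S"
  proof (rule packing_bound[OF J sep])
    show "ball (x j) r \<subseteq> S" if "j \<in> J" for j
    proof
      fix w assume "w \<in> ball (x j) r"
      then have "norm (x j - w) < r" by (simp add: dist_norm)
      then show "w \<in> S"
        using norm_triangle_ineq2[of "x j" w] norm_triangle_ineq2[of w "x j"] sph[OF that]
        by (simp add: S_def norm_minus_commute)
    qed
    have "emeasure lborel S \<le> emeasure lborel (ball (0 :: real ^ 3) (1 + r))"
      by (rule emeasure_mono) (auto simp: S_def)
    also have "\<dots> < \<infinity>" by (simp add: emeasure_ball_less_top)
    finally show "S \<in> fmeasurable lborel"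
      by (intro fmeasurableI) (auto simp: S_def)
  qed (use r in auto)
  also have "measure lborel S = measure lborel (ball (0 :: real ^ 3) (1 + r)) - measure lborel (ball (0 :: real ^ 3) (1 - r))"
    unfolding S_def using r
    by (intro measure_Diff) (auto simp: emeasure_ball_less_top less_imp_neq)
  also have "\<dots> = unit_ball_vol 3 * ((1 + r) ^ 3 - (1 - r) ^ 3)"
    using r by (simp add: content_ball right_diff_distrib)
  finally have "real (card J) * r ^ 3 \<le> (1 + r) ^ 3 - (1 - r) ^ 3"
    by - (rule unit_ball_vol_3_cancel, simp)
  also have "\<dots> = (6 + 2 * r\<^sup>2) * r" by (simp add: power2_eq_square power3_eq_cube algebra_simps)
  finally have "r * (real (card J) * r\<^sup>2) \<le> r * (6 + 2 * r\<^sup>2)"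
    by (simp add: power2_eq_square power3_eq_cube algebra_simps)
  then have "real (card J) * r\<^sup>2 \<le> 6 + 2 * r\<^sup>2"
    using r by (simp only: mult_le_cancel_left_pos)
  also have "\<dots> \<le> 8" using r power_le_one[of r 2] by simp
  finally show ?thesis using r by (simp add: field_simps)
qed

lemma dyadic_scale:
  fixes d t :: real
  assumes "d \<le> t" "t < 2 ^ K * d"
  shows "\<exists>k<K. 2 ^ k * d \<le> t \<and> t < 2 ^ Suc k * d"
  using assms
proof (induction K)
  case (Suc K)
  then show ?case by (cases "t < 2 ^ K * d") (auto intro: less_SucI)
qed simp

text \<open>Dyadic decomposition with \<open>d = 2 * r\<close>: at most \<open>125 * 8^k\<close>
  points lie closer than \<open>2^(k+1) * d\<close>, and those in the shell from
  \<open>2^k * d\<close> contribute at most \<open>1 / (2^k * d)^4\<close> each. The resulting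
  geometric series with ratio 1/2 doubles 125 to 250.\<close>

lemma sum_inverse_power4_le:
  fixes x :: "'b \<Rightarrow> real ^ 3"
  assumes J: "finite J" and sep: "\<And>i j. i \<in> J \<Longrightarrow> j \<in> J \<Longrightarrow> i \<noteq> j \<Longrightarrow> 2 * r \<le> dist (x i) (x j)"
    and r: "0 < r" and y: "\<And>j. j \<in> J \<Longrightarrow> 2 * r \<le> dist y (x j)"
  shows "(\<Sum>j\<in>J. 1 / dist y (x j) ^ 4) \<le> 250 / (2 * r) ^ 4"
proof -
  define d where "d = 2 * r"
  have d: "d > 0" using r by (simp add: d_def)
  define M where "M = Max (insert 0 ((\<lambda>j. dist y (x j)) ` J))"
  have M: "dist y (x j) \<le> M" if "j \<in> J" for j
    unfolding M_def using J that by (intro Max_ge) auto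
  obtain K where "M / d < 2 ^ K" using real_arch_pow[of 2 "M / d"] by auto
  then have K: "M < 2 ^ K * d" using d by (simp add: field_simps)
  define c where "c k = 1 / (2 ^ k * d) ^ 4" for k :: nat
  have "(\<Sum>j\<in>J. 1 / dist y (x j) ^ 4) \<le> (\<Sum>j\<in>J. \<Sum>k<K. if dist y (x j) < 2 ^ Suc k * d then c k else 0)"
  proof (rule sum_mono)
    fix j assume j: "j \<in> J"
    obtain k where k: "k < K" "2 ^ k * d \<le> dist y (x j)" "dist y (x j) < 2 ^ Suc k * d"
      using dyadic_scale[of d "dist y (x j)" K] y[OF j] M[OF j] K by (auto simp: d_def)
    have "1 / dist y (x j) ^ 4 \<le> c k"
    proof -
      have "0 < (2 ^ k * d) ^ 4" using d by simp
      moreover have "(2 ^ k * d) ^ 4 \<le> dist y (x j) ^ 4"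
        using k(2) d by (intro power_mono) auto
      ultimately show ?thesis unfolding c_def by (intro divide_left_mono mult_pos_pos) auto
    qed
    also have "\<dots> \<le> (\<Sum>k<K. if dist y (x j) < 2 ^ Suc k * d then c k else 0)"
      using member_le_sum[of k "{..<K}" "\<lambda>k. if dist y (x j) < 2 ^ Suc k * d then c k else 0"] k d
      by (auto simp: c_def)
    finally show "1 / dist y (x j) ^ 4 \<le> (\<Sum>k<K. if dist y (x j) < 2 ^ Suc k * d then c k else 0)" .
  qed
  also have "\<dots> = (\<Sum>k<K. \<Sum>j\<in>J. if dist y (x j) < 2 ^ Suc k * d then c k else 0)"
    by (rule sum.swap)
  also have "\<dots> \<le> (\<Sum>k<K. 125 / d ^ 4 * (1 / 2) ^ k)"
  proof (rule sum_mono)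
    fix k
    define I where "I = {j \<in> J. dist y (x j) < 2 ^ Suc k * d}"
    have "real (card I) * r ^ 3 \<le> (2 ^ Suc k * d + r) ^ 3"
      using J sep r d by (intro card_in_ball[of I r x _ y]) (auto simp: I_def)
    \<comment> \<open>The radius is \<open>4 * 2^k * r\<close> and the added \<open>r\<close> is at
      most \<open>2^k * r\<close>; the cube of 5 is the constant 125.\<close>
    also have "\<dots> \<le> (5 * 2 ^ k * r) ^ 3"
    proof (intro power_mono)
      have "1 * r \<le> 2 ^ k * r" using r by (intro mult_right_mono) auto
      moreover have "5 * 2 ^ k * r = 2 ^ Suc k * d + 2 ^ k * r" by (simp add: d_def)
      ultimately show "2 ^ Suc k * d + r \<le> 5 * 2 ^ k * r" by linarith
    qed (use r d in auto)
    also have "\<dots> = (125 * (2 ^ k) ^ 3) * r ^ 3" by (simp add: power_mult_distrib)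
    finally have I: "real (card I) \<le> 125 * (2 ^ k) ^ 3" using r by simp
    have "(\<Sum>j\<in>J. if dist y (x j) < 2 ^ Suc k * d then c k else 0) = real (card I) * c k"
      using J by (simp add: sum.If_cases I_def Int_def)
    also have "\<dots> \<le> (125 * (2 ^ k) ^ 3) * c k"
      using d by (intro mult_right_mono I) (auto simp: c_def)
    also have "\<dots> = 125 / d ^ 4 * (1 / 2) ^ k"
      by (simp add: c_def power_mult_distrib power_divide eval_nat_numeral)
    finally show "(\<Sum>j\<in>J. if dist y (x j) < 2 ^ Suc k * d then c k else 0) \<le> 125 / d ^ 4 * (1 / 2) ^ k" .
  qed
  also have "\<dots> = 125 / d ^ 4 * (\<Sum>k<K. (1 / 2) ^ k)" by (simp add: sum_distrib_left)
  also have "\<dots> \<le> 125 / d ^ 4 * 2"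
  proof (intro mult_left_mono)
    have "(\<Sum>k<K. (1 / 2 :: real) ^ k) = 2 - 2 * (1 / 2) ^ K" by (induction K) auto
    then show "(\<Sum>k<K. (1 / 2 :: real) ^ k) \<le> 2" by simp
  qed (use d in auto)
  finally show ?thesis by (simp add: d_def)
qed

text \<open>A Gershgorin-type bound on the quadratic form: summing
  \<open>0 \<le> (v i + v j)^2 * C i j\<close> bounds the off-diagonal part from below by minus the
  row sums weighted with \<open>(v i)^2\<close>.\<close>

lemma diagonal_dominance:
  fixes B :: "'b \<Rightarrow> 'b \<Rightarrow> real"
  assumes I: "finite I" and sym: "\<And>i j. i \<in> I \<Longrightarrow> j \<in> I \<Longrightarrow> B i j = B j i"
    and nn: "\<And>i j. i \<in> I \<Longrightarrow> j \<in> I \<Longrightarrow> 0 \<le> B i j"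
    and D: "\<And>i. i \<in> I \<Longrightarrow> B i i = D"
    and S: "\<And>i. i \<in> I \<Longrightarrow> (\<Sum>j\<in>I - {i}. B i j) \<le> S"
  shows "(D - S) * (\<Sum>i\<in>I. (v i)\<^sup>2) \<le> (\<Sum>i\<in>I. \<Sum>j\<in>I. v i * v j * B i j)"
proof -
  define C where "C i j = (if i = j then 0 else B i j)" for i j
  have C_sum: "(\<Sum>j\<in>I. C i j) \<le> S" if "i \<in> I" for i
  proof -
    have "(\<Sum>j\<in>I. C i j) = (\<Sum>j\<in>I - {i}. B i j)"
      using I that by (intro sum.mono_neutral_cong_right) (auto simp: C_def)
    then show ?thesis using S[OF that] by simp
  qed
  have "(\<Sum>i\<in>I. \<Sum>j\<in>I. (v i)\<^sup>2 * C j i) = (\<Sum>i\<in>I. \<Sum>j\<in>I. (v j)\<^sup>2 * C i j)"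
    by (rule sum.swap)
  moreover have "(\<Sum>i\<in>I. \<Sum>j\<in>I. (v i)\<^sup>2 * C j i) = (\<Sum>i\<in>I. \<Sum>j\<in>I. (v i)\<^sup>2 * C i j)"
    by (intro sum.cong refl) (auto simp: C_def sym)
  moreover have "0 \<le> (\<Sum>i\<in>I. \<Sum>j\<in>I. (v i + v j)\<^sup>2 * C i j)"
    by (intro sum_nonneg mult_nonneg_nonneg) (auto simp: C_def nn)
  moreover have "(\<Sum>i\<in>I. \<Sum>j\<in>I. (v i + v j)\<^sup>2 * C i j) =
     (\<Sum>i\<in>I. \<Sum>j\<in>I. (v i)\<^sup>2 * C i j) + (\<Sum>i\<in>I. \<Sum>j\<in>I. (v j)\<^sup>2 * C i j) + 2 * (\<Sum>i\<in>I. \<Sum>j\<in>I. v i * v j * C i j)"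
  proof -
    have "(v i + v j)\<^sup>2 * C i j = (v i)\<^sup>2 * C i j + (v j)\<^sup>2 * C i j + 2 * (v i * v j * C i j)" for i j
      by (simp add: power2_sum algebra_simps)
    then show ?thesis by (simp only: sum.distrib sum_distrib_left)
  qed
  ultimately have a: "- (\<Sum>i\<in>I. \<Sum>j\<in>I. (v i)\<^sup>2 * C i j) \<le> (\<Sum>i\<in>I. \<Sum>j\<in>I. v i * v j * C i j)"
    by linarith
  have "(\<Sum>i\<in>I. \<Sum>j\<in>I. (v i)\<^sup>2 * C i j) \<le> (\<Sum>i\<in>I. (v i)\<^sup>2 * S)"
    unfolding sum_distrib_left[symmetric] by (intro sum_mono mult_left_mono C_sum) auto
  then have b: "(\<Sum>i\<in>I. \<Sum>j\<in>I. (v i)\<^sup>2 * C i j) \<le> S * (\<Sum>i\<in>I. (v i)\<^sup>2)"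
    by (simp add: sum_distrib_left mult.commute)
  have "(\<Sum>j\<in>I. v i * v j * B i j) = D * (v i)\<^sup>2 + (\<Sum>j\<in>I. v i * v j * C i j)" if "i \<in> I" for i
  proof -
    have "(\<Sum>j\<in>I. v i * v j * B i j) = (\<Sum>j\<in>I. (if j = i then D * (v i)\<^sup>2 else 0) + v i * v j * C i j)"
      by (intro sum.cong) (auto simp: C_def D power2_eq_square)
    then show ?thesis using I that by (simp add: sum.distrib)
  qed
  then have "(\<Sum>i\<in>I. \<Sum>j\<in>I. v i * v j * B i j) = D * (\<Sum>i\<in>I. (v i)\<^sup>2) + (\<Sum>i\<in>I. \<Sum>j\<in>I. v i * v j * C i j)"
    by (simp add: sum.distrib sum_distrib_left)
  then show ?thesis using a b by (simp add: algebra_simps)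
qed

section \<open>Spectra of real symmetric matrices\<close>

lemma sum_norm_vec_pos:
  fixes v :: "'a :: real_normed_field Matrix.vec"
  assumes "v \<in> carrier_vec n" "v \<noteq> 0\<^sub>v n"
  shows "0 < (\<Sum>i<n. (norm (vec_index v i))\<^sup>2)"
proof -
  obtain i where i: "i < n" "vec_index v i \<noteq> 0"
    using assms by (metis carrier_vecD dim_vec(1) eq_vecI index_zero_vec(1) index_zero_vec(2))
  show ?thesis by (rule sum_pos2[of _ i]) (use i in auto)
qed

text \<open>The complexified matrix has an eigenvalue. Its Hermitian form is real by symmetry, so
  the eigenvalue is real and a root of the real characteristic polynomial. Without this the
  \<open>Min\<close> and \<open>Max\<close> over the spectrum could not be bounded.\<close>

lemma real_symmetric_spectrum_nonempty:
  fixes A :: "real mat"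
  assumes A: "A \<in> carrier_mat n n" and n: "n > 0" and sym: "\<And>i j. i < n \<Longrightarrow> j < n \<Longrightarrow> A $$ (i, j) = A $$ (j, i)"
  shows "spectrum A \<noteq> {}"
proof -
  define B where "B = map_mat complex_of_real A"
  have B: "B \<in> carrier_mat n n" using A by (simp add: B_def)
  obtain k where k: "eigenvalue B k"
    using spectrum_non_empty[OF B n] by (auto simp: spectrum_def)
  then obtain v where v: "v \<in> carrier_vec n" "v \<noteq> 0\<^sub>v n" "B *\<^sub>v v = k \<cdot>\<^sub>v v"
    using B by (auto simp: eigenvalue_def eigenvector_def)
  have row: "(\<Sum>j<n. complex_of_real (A $$ (i, j)) * vec_index v j) = k * vec_index v i" if "i < n" for i
  proof -
    have "vec_index (B *\<^sub>v v) i = (\<Sum>j<n. complex_of_real (A $$ (i, j)) * vec_index v j)"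
      using that A v(1) by (simp add: B_def scalar_prod_def atLeast0LessThan)
    then show ?thesis using that v by simp
  qed
  define F where "F = (\<Sum>i<n. \<Sum>j<n. complex_of_real (A $$ (i, j)) * vec_index v j * cnj (vec_index v i))"
  define V where "V = (\<Sum>i<n. (cmod (vec_index v i))\<^sup>2)"
  have "F = (\<Sum>i<n. k * vec_index v i * cnj (vec_index v i))"
    unfolding F_def by (intro sum.cong refl) (simp add: row sum_distrib_right[symmetric])
  also have "\<dots> = k * complex_of_real V"
    unfolding V_def of_real_sum sum_distrib_left
    by (intro sum.cong refl) (simp add: complex_norm_square[symmetric] mult.assoc)
  finally have FV: "F = k * complex_of_real V" .
  have "cnj F = (\<Sum>i<n. \<Sum>j<n. complex_of_real (A $$ (i, j)) * cnj (vec_index v j) * vec_index v i)"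
    by (simp add: F_def)
  also have "\<dots> = (\<Sum>j<n. \<Sum>i<n. complex_of_real (A $$ (i, j)) * cnj (vec_index v j) * vec_index v i)"
    by (rule sum.swap)
  also have "\<dots> = F"
    unfolding F_def by (intro sum.cong refl) (simp add: sym mult_ac)
  finally have cF: "cnj F = F" .
  have "V > 0"
    unfolding V_def by (rule sum_norm_vec_pos[OF v(1,2)])
  then have "cnj k = k" using cF unfolding FV by simp
  then have k': "k = complex_of_real (Re k)"
    by (metis Reals_cnj_iff complex_is_Real_iff of_real_Re)
  have "poly (char_poly B) k = 0"
    using k eigenvalue_root_char_poly[OF B] by simp
  then have "complex_of_real (poly (char_poly A) (Re k)) = 0"
    unfolding B_def of_real_hom.char_poly_hom[OF A] by (subst (asm) k') simp
  then have "eigenvalue A (Re k)"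
    using eigenvalue_root_char_poly[OF A] by simp
  then show ?thesis by (auto simp: spectrum_def)
qed

lemma quadratic_form_mat:
  fixes f :: "nat \<Rightarrow> nat \<Rightarrow> real"
  assumes "v \<in> carrier_vec N"
  shows "scalar_prod v (mat N N (\<lambda>(i, j). f i j) *\<^sub>v v) = (\<Sum>i<N. \<Sum>j<N. vec_index v i * vec_index v j * f i j)"
proof -
  have "vec_index (mat N N (\<lambda>(i, j). f i j) *\<^sub>v v) i = (\<Sum>j<N. f i j * vec_index v j)" if "i < N" for i
    using that assms by (simp add: scalar_prod_def atLeast0LessThan)
  then have "scalar_prod v (mat N N (\<lambda>(i, j). f i j) *\<^sub>v v) = (\<Sum>i<N. vec_index v i * (\<Sum>j<N. f i j * vec_index v j))"
    by (simp add: scalar_prod_def atLeast0LessThan del: index_mult_mat_vec)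
  also have "\<dots> = (\<Sum>i<N. \<Sum>j<N. vec_index v i * vec_index v j * f i j)"
    unfolding sum_distrib_left by (intro sum.cong refl) (simp add: mult_ac)
  finally show ?thesis .
qed

text \<open>An eigenvalue is the Rayleigh quotient of its eigenvector.\<close>

lemma spectrum_bounds:
  fixes f :: "nat \<Rightarrow> nat \<Rightarrow> real"
  assumes lower: "\<And>v. lo * (\<Sum>i<N. (v i)\<^sup>2) \<le> (\<Sum>i<N. \<Sum>j<N. v i * v j * f i j)"
    and upper: "\<And>v. (\<Sum>i<N. \<Sum>j<N. v i * v j * f i j) \<le> hi * (\<Sum>i<N. (v i)\<^sup>2)"
    and k: "k \<in> spectrum (mat N N (\<lambda>(i, j). f i j))"
  shows "lo \<le> k" "k \<le> hi"
proof -
  obtain v where v: "v \<in> carrier_vec N" "v \<noteq> 0\<^sub>v N" "mat N N (\<lambda>(i, j). f i j) *\<^sub>v v = k \<cdot>\<^sub>v v"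
    using k by (auto simp: spectrum_def eigenvalue_def eigenvector_def)
  define V where "V = (\<Sum>i<N. (vec_index v i)\<^sup>2)"
  have V: "V > 0"
    using sum_norm_vec_pos[OF v(1,2)] by (simp add: V_def)
  have "(\<Sum>i<N. \<Sum>j<N. vec_index v i * vec_index v j * f i j) = scalar_prod v (k \<cdot>\<^sub>v v)"
    using quadratic_form_mat[OF v(1), of f] v(3) by simp
  also have "\<dots> = k * V"
    using v(1) by (simp add: scalar_prod_def atLeast0LessThan V_def sum_distrib_left power2_eq_square mult_ac)
  finally have "lo * V \<le> k * V" "k * V \<le> hi * V"
    using lower[of "vec_index v"] upper[of "vec_index v"] by (auto simp: V_def)
  then show "lo \<le> k" "k \<le> hi" using V by auto
qed

section \<open>The discrepancy matrix\<close>

text \<open>Up to normalization, \<open>b k\<close> is the integral of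
  \<open>p * legendre k\<close>. Since \<open>p\<close> is nonnegative and \<open>legendre k\<close>
  is at most 1 on the interval, that integral is at most the one of \<open>p\<close>.\<close>

lemma nonneg_expansion_le:
  assumes p: "p = (\<Sum>l\<le>L. Polynomial.smult (b l) (legendre l))"
    and nonneg: "\<And>u. \<bar>u\<bar> \<le> 1 \<Longrightarrow> 0 \<le> poly p u" and k: "k \<le> L"
  shows "b k \<le> real (2 * k + 1) * b 0"
proof -
  have "sym_integral (p * legendre k) \<le> sym_integral p"
    using mult_left_mono[OF abs_le_D1[OF abs_legendre_le_1] nonneg]
    by (intro sym_integral_mono) simp
  then have "real (2 * k + 1) * sym_integral (p * legendre k) \<le> real (2 * k + 1) * sym_integral p"
    by (intro mult_left_mono) auto
  moreover have "sym_integral p = 2 * b 0"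
    using sym_integral_expansion[OF p, of 0] by simp
  ultimately have "2 * b k \<le> real (2 * k + 1) * (2 * b 0)"
    using sym_integral_expansion[OF p k] by (simp only:)
  then show ?thesis by simp
qed

lemma dist_sphere:
  fixes x y :: "real ^ 3"
  assumes "norm x = 1" "norm y = 1"
  shows "dist x y ^ 2 = 2 * (1 - inner x y)"
  using assms by (simp add: dist_norm power2_norm_eq_inner inner_diff_left inner_diff_right norm_eq_1 inner_commute)

text \<open>On the sphere \<open>1 - u\<close> is half the squared distance, so an off-diagonal
  entry is at most \<open>16 / dist^4\<close>. The packing sum with spacing \<open>2 * r\<close>
  then gives \<open>16 * 250 / (2 * r)^4 = 250 / r^4\<close>.\<close>

lemma localized_form_bound:
  fixes x :: "nat \<Rightarrow> real ^ 3" and v :: "nat \<Rightarrow> real"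
  assumes sph: "\<And>i. i < N \<Longrightarrow> norm (x i) = 1"
    and sep: "\<And>i j. i < N \<Longrightarrow> j < N \<Longrightarrow> i \<noteq> j \<Longrightarrow> 2 * r \<le> dist (x i) (x j)" and r: "0 < r"
  shows "(real n ^ 4 - 250 / r ^ 4) * (\<Sum>i<N. (v i)\<^sup>2)
    \<le> (\<Sum>i<N. \<Sum>j<N. v i * v j * poly ((fejer n)\<^sup>2) (inner (x i) (x j)))"
proof (rule diagonal_dominance)
  have u: "\<bar>inner (x i) (x j)\<bar> \<le> 1" if "i < N" "j < N" for i j
    using Cauchy_Schwarz_ineq2[of "x i" "x j"] sph that by simp
  fix i assume i: "i \<in> {..<N}"
  show "poly ((fejer n)\<^sup>2) (inner (x i) (x i)) = real n ^ 4"
    using sph[of i] i by (simp add: fejer_1 norm_eq_1)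
  have "(\<Sum>j\<in>{..<N} - {i}. poly ((fejer n)\<^sup>2) (inner (x i) (x j))) \<le> (\<Sum>j\<in>{..<N} - {i}. 16 * (1 / dist (x i) (x j) ^ 4))"
  proof (rule sum_mono)
    fix j assume j: "j \<in> {..<N} - {i}"
    define w where "w = inner (x i) (x j)"
    define d where "d = dist (x i) (x j)"
    have d: "d > 0" using sep[of i j] i j r by (auto simp: d_def)
    have w: "1 - w = d\<^sup>2 / 2" using dist_sphere[of "x i" "x j"] sph i j by (simp add: w_def d_def)
    have "\<bar>w\<bar> \<le> 1" using u i j by (simp add: w_def)
    note f = fejer_bounds[OF this, of n]
    have "poly (fejer n) w \<le> 4 / d\<^sup>2"
      using f(3) d unfolding w by (simp add: field_simps)
    then have "(poly (fejer n) w)\<^sup>2 \<le> (4 / d\<^sup>2)\<^sup>2"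
      using f(1) by (rule power_mono)
    then show "poly ((fejer n)\<^sup>2) (inner (x i) (x j)) \<le> 16 * (1 / dist (x i) (x j) ^ 4)"
      by (simp add: w_def d_def power_divide)
  qed
  also have "\<dots> = 16 * (\<Sum>j\<in>{..<N} - {i}. 1 / dist (x i) (x j) ^ 4)"
    by (simp only: sum_distrib_left)
  also have "\<dots> \<le> 16 * (250 / (2 * r) ^ 4)"
    using sep r i by (intro mult_left_mono sum_inverse_power4_le) auto
  also have "\<dots> = 250 / r ^ 4" by (simp add: power_mult_distrib)
  finally show "(\<Sum>j\<in>{..<N} - {i}. poly ((fejer n)\<^sup>2) (inner (x i) (x j))) \<le> 250 / r ^ 4" .
  fix j assume j: "j \<in> {..<N}"
  show "0 \<le> poly ((fejer n)\<^sup>2) (inner (x i) (x j))" by simp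
  show "poly ((fejer n)\<^sup>2) (inner (x i) (x j)) = poly ((fejer n)\<^sup>2) (inner (x j) (x i))"
    by (simp add: inner_commute)
qed simp

lemma sum_square_le_card:
  fixes v :: "nat \<Rightarrow> real"
  shows "(\<Sum>i<N. v i)\<^sup>2 \<le> real N * (\<Sum>i<N. (v i)\<^sup>2)"
  using Cauchy_Schwarz_ineq_sum[of "\<lambda>_. 1" v "{..<N}"] by simp

text \<open>
  Since \<open>(fejer n)\<^sup>2\<close> is nonnegative, its \<open>l\<close>-th Legendre coefficient is at most \<open>2 l + 1\<close> times its mean,
  so its kernel is dominated by that of the sum over all degrees \<open>0, \<dots>, L\<close>. The missing degree \<open>0\<close> costs
  only \<open>(\<Sum> v\<^sub>i)\<^sup>2 \<le> N |v|\<^sup>2\<close>, where \<open>N = O(r\<^sup>-\<^sup>2)\<close>.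
\<close>

lemma unweighted_form_bound:
  fixes x :: "nat \<Rightarrow> real ^ 3" and v :: "nat \<Rightarrow> real"
  assumes sph: "\<And>i. i < N \<Longrightarrow> norm (x i) = 1"
    and sep: "\<And>i j. i < N \<Longrightarrow> j < N \<Longrightarrow> i \<noteq> j \<Longrightarrow> 2 * r \<le> dist (x i) (x j)"
    and r: "0 < r" "r \<le> 1" and n: "8 \<le> real n * r" and L: "2 * (n - 1) \<le> L"
  shows "8 / r\<^sup>2 * (\<Sum>i<N. (v i)\<^sup>2)
    \<le> (\<Sum>l = 1..L. real (2 * l + 1) * (\<Sum>i<N. \<Sum>j<N. v i * v j * poly (legendre l) (inner (x i) (x j))))"
proof -
  define Q where "Q l = (\<Sum>i<N. \<Sum>j<N. v i * v j * poly (legendre l) (inner (x i) (x j)))" for l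
  define V where "V = (\<Sum>i<N. (v i)\<^sup>2)"
  define T where "T = (\<Sum>l = 1..L. real (2 * l + 1) * Q l)"
  have V: "V \<ge> 0" unfolding V_def by (intro sum_nonneg) auto
  have Q: "Q l \<ge> 0" for l
    unfolding Q_def by (intro legendre_psd) (auto simp: norm_eq_1[symmetric] sph)
  have T: "T \<ge> 0" unfolding T_def by (intro sum_nonneg mult_nonneg_nonneg Q) auto
  have n2: "n \<ge> 2"
  proof (rule ccontr)
    assume "\<not> n \<ge> 2"
    then have "real n * r \<le> 1 * 1" using r by (intro mult_mono) auto
    then show False using n by simp
  qed
  define p where "p = (fejer n)\<^sup>2"
  have "degree p \<le> degree (fejer n) * 2" unfolding p_def by (rule degree_power_le)
  then have "degree p \<le> L" using degree_fejer[of n] L by linarith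
  then obtain b where p: "p = (\<Sum>l\<le>L. Polynomial.smult (b l) (legendre l))"
    using legendre_expansion by blast
  have b0: "2 * b 0 = sym_integral p" using sym_integral_expansion[OF p, of 0] by simp
  have "sym_integral 0 \<le> sym_integral p" by (rule sym_integral_mono) (simp add: p_def)
  then have b0_nonneg: "0 \<le> b 0" using b0 by (simp add: sym_integral_0)
  have b0_le: "b 0 \<le> 2 * (real n)\<^sup>2"
    using integral_fejer_sq_le[OF n2] b0 by (simp add: sym_integral_def p_def)
  have Q0: "Q 0 \<le> real N * V"
    using sum_square_le_card[of v N]
    by (simp add: Q_def V_def power2_eq_square sum_product)
  have N: "real N \<le> 8 / r\<^sup>2"
    using card_on_sphere[of "{..<N}" r x] sep r sph by simp
  have "(real n ^ 4 - 250 / r ^ 4) * V \<le> (\<Sum>i<N. \<Sum>j<N. v i * v j * poly p (inner (x i) (x j)))"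
    unfolding V_def p_def by (rule localized_form_bound) (use sph sep r in auto)
  also have "\<dots> = (\<Sum>i<N. \<Sum>j<N. \<Sum>l\<le>L. b l * (v i * v j * poly (legendre l) (inner (x i) (x j))))"
    by (intro sum.cong refl) (simp add: p poly_sum sum_distrib_left mult_ac)
  also have "\<dots> = (\<Sum>i<N. \<Sum>l\<le>L. \<Sum>j<N. b l * (v i * v j * poly (legendre l) (inner (x i) (x j))))"
    by (intro sum.cong refl sum.swap)
  also have "\<dots> = (\<Sum>l\<le>L. \<Sum>i<N. \<Sum>j<N. b l * (v i * v j * poly (legendre l) (inner (x i) (x j))))"
    by (rule sum.swap)
  also have "\<dots> = (\<Sum>l\<le>L. b l * Q l)"
    unfolding Q_def by (simp only: sum_distrib_left)
  also have "\<dots> \<le> (\<Sum>l\<le>L. real (2 * l + 1) * b 0 * Q l)"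
    by (intro sum_mono mult_right_mono Q nonneg_expansion_le[OF p]) (auto simp: p_def)
  also have "\<dots> = b 0 * (Q 0 + T)"
  proof -
    have "(\<Sum>l\<le>L. real (2 * l + 1) * Q l) = Q 0 + T"
      unfolding T_def atMost_atLeast0 by (simp add: sum.atLeast_Suc_atMost)
    moreover have "(\<Sum>l\<le>L. real (2 * l + 1) * b 0 * Q l) = b 0 * (\<Sum>l\<le>L. real (2 * l + 1) * Q l)"
      unfolding sum_distrib_left by (intro sum.cong refl) (simp add: mult_ac)
    ultimately show ?thesis by (simp only:)
  qed
  also have "\<dots> \<le> 2 * (real n)\<^sup>2 * (real N * V + T)"
    using b0_le Q0 T Q[of 0] by (intro mult_mono add_mono) auto
  also have "\<dots> \<le> 2 * (real n)\<^sup>2 * (8 / r\<^sup>2 * V + T)"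
    using N V by (intro mult_left_mono add_mono mult_right_mono) auto
  finally have main: "(real n ^ 4 - 250 / r ^ 4) * V \<le> 2 * (real n)\<^sup>2 * (8 / r\<^sup>2 * V + T)" .
  define w where "w = (real n)\<^sup>2"
  define z where "z = 1 / r\<^sup>2"
  have z: "z > 0" using r by (simp add: z_def)
  have "8\<^sup>2 \<le> (real n * r)\<^sup>2" using n by (intro power_mono) auto
  then have wz: "64 * z \<le> w" using r by (simp add: w_def z_def power_mult_distrib field_simps)
  then have w: "w > 0" using z by linarith
  \<comment> \<open>Of the 32, one half pays for degree 0 and the other half is the bound to be
    shown, each being \<open>2 * w\<close> times \<open>8 * z\<close>. From
    \<open>64 * z \<le> w\<close> the left side is at most \<open>36 * (w * z)\<close>, and
    \<open>w^2\<close> is at least \<open>64 * (w * z)\<close>.\<close>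
  have "250 * z\<^sup>2 + 32 * (w * z) \<le> w\<^sup>2"
  proof -
    have "64 * z\<^sup>2 \<le> w * z"
      using mult_right_mono[OF wz, of z] z by (simp add: power2_eq_square mult_ac)
    moreover have "64 * (w * z) \<le> w\<^sup>2"
      using mult_left_mono[OF wz, of w] w by (simp add: power2_eq_square mult_ac)
    moreover have "0 \<le> z\<^sup>2" by simp
    ultimately show ?thesis by linarith
  qed
  then have "(32 * (w * z)) * V \<le> (w\<^sup>2 - 250 * z\<^sup>2) * V"
    using V by (intro mult_right_mono) auto
  also have "\<dots> \<le> 2 * w * (8 * z * V + T)"
    using main by (simp add: w_def z_def power_divide flip: power_mult)
  finally have "(2 * w) * (8 * z * V) \<le> (2 * w) * T" by (simp add: algebra_simps)
  then have "8 * z * V \<le> T" using w by (simp add: mult_ac)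
  then show ?thesis by (simp add: z_def V_def T_def Q_def)
qed

section \<open>Geodesic and Euclidean separation\<close>

lemma jordan_sin_inequality:
  assumes "0 \<le> t" "t \<le> pi / 2"
  shows "2 * t / pi \<le> sin t"
proof -
  have "convex_on {0..pi / 2} (\<lambda>t. - sin t)"
  proof (rule f''_ge0_imp_convex)
    fix t :: real assume "t \<in> {0..pi / 2}"
    then show "0 \<le> sin t" by (intro sin_ge_zero) auto
    show "((\<lambda>t. - sin t) has_real_derivative - cos t) (at t)"
      and "((\<lambda>t. - cos t) has_real_derivative sin t) (at t)"
      by (auto intro!: derivative_eq_intros)
  qed auto
  from convex_onD[OF this, of "2 * t / pi" 0 "pi / 2"] assms show ?thesis
    by (simp add: field_simps)
qed

text \<open>The chord of an arc of length \<open>t\<close> is \<open>2 * sin (t / 2)\<close>, and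
  Jordan's inequality bounds it below by \<open>2 * t / pi\<close>.\<close>

lemma geodesic_le_dist:
  assumes "norm x = 1" "norm y = 1"
  shows "2 * (geodesic_dist x y / pi) \<le> dist x y"
proof -
  define t where "t = geodesic_dist x y"
  have "\<bar>inner x y\<bar> \<le> 1" using Cauchy_Schwarz_ineq2[of x y] assms by simp
  then have t: "0 \<le> t" "t \<le> pi" "inner x y = cos t"
    unfolding t_def geodesic_dist_def by (auto simp: arccos_lbound arccos_ubound abs_le_iff)
  have "(dist x y)\<^sup>2 = (2 * sin (t / 2))\<^sup>2"
    using dist_sphere[OF assms] cos_double_sin[of "t / 2"] by (simp add: t(3))
  moreover have "0 \<le> sin (t / 2)" using t by (intro sin_ge_zero) auto
  ultimately have "dist x y = 2 * sin (t / 2)"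
    by - (rule power2_eq_imp_eq, simp_all)
  moreover have "t / pi \<le> sin (t / 2)"
    using jordan_sin_inequality[of "t / 2"] t by simp
  ultimately show ?thesis by (simp add: t_def)
qed

lemma separation_dist_props:
  assumes N: "N \<ge> 2" and sph: "\<And>i. i < N \<Longrightarrow> norm (x i) = 1" and inj: "inj_on x {..<N}"
  shows "0 < separation_dist N x" "separation_dist N x \<le> pi"
    and "\<And>i j. i < N \<Longrightarrow> j < N \<Longrightarrow> i \<noteq> j \<Longrightarrow> separation_dist N x \<le> geodesic_dist (x i) (x j)"
proof -
  define G where "G = {geodesic_dist (x i) (x j) | i j. i < N \<and> j < N \<and> i \<noteq> j}"
  have "G \<subseteq> (\<lambda>(i, j). geodesic_dist (x i) (x j)) ` ({..<N} \<times> {..<N})"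
    by (auto simp: G_def)
  then have fin: "finite G" by (rule finite_subset) auto
  have "geodesic_dist (x 0) (x 1) \<in> G" using N by (force simp: G_def)
  then have ne: "G \<noteq> {}" by blast
  have q: "separation_dist N x = Min G" by (simp add: separation_dist_def G_def)
  show "separation_dist N x \<le> geodesic_dist (x i) (x j)" if "i < N" "j < N" "i \<noteq> j" for i j
    unfolding q using fin that by (intro Min_le) (auto simp: G_def)
  obtain i j where ij: "i < N" "j < N" "i \<noteq> j" and qij: "separation_dist N x = geodesic_dist (x i) (x j)"
    using Min_in[OF fin ne] unfolding q[symmetric] by (auto simp: G_def)
  define w where "w = inner (x i) (x j)"
  have "\<bar>w\<bar> \<le> 1" using Cauchy_Schwarz_ineq2[of "x i" "x j"] sph ij by (simp add: w_def)
  moreover have "x i \<noteq> x j" using inj ij by (auto dest: inj_onD)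
  then have "0 < (dist (x i) (x j))\<^sup>2" by simp
  then have "w < 1" using dist_sphere[of "x i" "x j"] sph ij by (simp add: w_def)
  ultimately have "0 < arccos w" "arccos w \<le> pi"
    using arccos_less_mono[of 1 w] by (auto simp: abs_le_iff arccos_ubound)
  then show "0 < separation_dist N x" "separation_dist N x \<le> pi"
    by (auto simp: qij geodesic_dist_def w_def)
qed

lemma sobolev_coeff_antimono: "s \<ge> 0 \<Longrightarrow> k \<le> l \<Longrightarrow> sobolev_coeff s l \<le> sobolev_coeff s k"
  unfolding sobolev_coeff_def by (rule powr_mono2') simp_all

lemma sobolev_coeff_pos: "sobolev_coeff s l > 0"
proof -
  have "real l + 1 / 2 > 0" by (simp add: add_nonneg_pos)
  then show ?thesis by (simp add: sobolev_coeff_def)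
qed

lemma trunc_kernel_form:
  "(\<Sum>i<N. \<Sum>j<N. v i * v j * trunc_kernel s L (x i) (x j)) =
     (\<Sum>l = 1..L. sobolev_coeff s l * real (2 * l + 1) *
        (\<Sum>i<N. \<Sum>j<N. v i * v j * poly (legendre l) (inner (x i) (x j)))) / (4 * pi)"
proof -
  define c where "c l = sobolev_coeff s l * real (2 * l + 1) / (4 * pi)" for l
  have "(\<Sum>i<N. \<Sum>j<N. v i * v j * trunc_kernel s L (x i) (x j)) =
     (\<Sum>i<N. \<Sum>j<N. \<Sum>l = 1..L. c l * (v i * v j * poly (legendre l) (inner (x i) (x j))))"
    unfolding trunc_kernel_def sum_distrib_left c_def by (intro sum.cong refl) (simp add: mult_ac)
  also have "\<dots> = (\<Sum>i<N. \<Sum>l = 1..L. \<Sum>j<N. c l * (v i * v j * poly (legendre l) (inner (x i) (x j))))"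
    by (intro sum.cong refl sum.swap)
  also have "\<dots> = (\<Sum>l = 1..L. \<Sum>i<N. \<Sum>j<N. c l * (v i * v j * poly (legendre l) (inner (x i) (x j))))"
    by (rule sum.swap)
  finally show ?thesis
    by (simp add: c_def sum_distrib_left sum_divide_distrib)
qed

lemma trunc_kernel_upper:
  assumes sph: "\<And>i. i < N \<Longrightarrow> norm (x i) = 1"
  shows "(\<Sum>i<N. \<Sum>j<N. v i * v j * trunc_kernel s L (x i) (x j))
    \<le> real N * (\<Sum>l = 1..L. (2 * real l + 1) * sobolev_coeff s l) / (4 * pi) * (\<Sum>i<N. (v i)\<^sup>2)"
proof -
  define D where "D = (\<Sum>l = 1..L. (2 * real l + 1) * sobolev_coeff s l) / (4 * pi)"
  have D: "D \<ge> 0"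
    unfolding D_def by (intro divide_nonneg_nonneg sum_nonneg mult_nonneg_nonneg less_imp_le[OF sobolev_coeff_pos]) auto
  have K: "\<bar>trunc_kernel s L (x i) (x j)\<bar> \<le> D" if "i < N" "j < N" for i j
  proof -
    have "\<bar>inner (x i) (x j)\<bar> \<le> 1"
      using Cauchy_Schwarz_ineq2[of "x i" "x j"] sph that by simp
    note P = abs_legendre_le_1[OF this]
    have "\<bar>trunc_kernel s L (x i) (x j)\<bar> \<le>
        (\<Sum>l = 1..L. \<bar>(2 * real l + 1) / (4 * pi) * sobolev_coeff s l * poly (legendre l) (inner (x i) (x j))\<bar>)"
      unfolding trunc_kernel_def by (rule sum_abs)
    also have "\<dots> \<le> (\<Sum>l = 1..L. (2 * real l + 1) / (4 * pi) * sobolev_coeff s l)"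
    proof (rule sum_mono)
      fix l
      have "\<bar>(2 * real l + 1) / (4 * pi) * sobolev_coeff s l\<bar> * \<bar>poly (legendre l) (inner (x i) (x j))\<bar>
          \<le> \<bar>(2 * real l + 1) / (4 * pi) * sobolev_coeff s l\<bar> * 1"
        by (intro mult_left_mono P) auto
      then show "\<bar>(2 * real l + 1) / (4 * pi) * sobolev_coeff s l * poly (legendre l) (inner (x i) (x j))\<bar>
          \<le> (2 * real l + 1) / (4 * pi) * sobolev_coeff s l"
        using sobolev_coeff_pos[of s l] by (simp add: abs_mult)
    qed
    also have "\<dots> = D" by (simp add: D_def sum_divide_distrib)
    finally show ?thesis .
  qed
  have "(\<Sum>i<N. \<Sum>j<N. v i * v j * trunc_kernel s L (x i) (x j)) \<le> (\<Sum>i<N. \<Sum>j<N. \<bar>v i\<bar> * \<bar>v j\<bar> * D)"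
  proof (intro sum_mono)
    fix i j assume "i \<in> {..<N}" "j \<in> {..<N}"
    then have "\<bar>v i * v j\<bar> * \<bar>trunc_kernel s L (x i) (x j)\<bar> \<le> \<bar>v i * v j\<bar> * D"
      by (intro mult_left_mono K) auto
    then show "v i * v j * trunc_kernel s L (x i) (x j) \<le> \<bar>v i\<bar> * \<bar>v j\<bar> * D"
      by (metis abs_mult abs_le_D1)
  qed
  also have "\<dots> = D * (\<Sum>i<N. \<bar>v i\<bar>)\<^sup>2"
    by (simp add: power2_eq_square sum_product sum_distrib_left mult_ac)
  also have "\<dots> \<le> D * (real N * (\<Sum>i<N. \<bar>v i\<bar>\<^sup>2))"
    by (intro mult_left_mono sum_square_le_card D)
  finally show ?thesis by (simp add: D_def mult_ac)
qed

theorem theorem4p13: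
  fixes N L :: nat and x :: "nat \<Rightarrow> real ^ 3" and s q :: real
  assumes "N \<ge> 2"
    and "\<And>i. i < N \<Longrightarrow> x i \<in> sphere 0 1"
    and "inj_on x {..<N}"
    and "s \<ge> 0"
    and "q = separation_dist N x"
    and "L = nat \<lceil>55 / q\<rceil>"
  shows "sym_pos_def (discrepancy_matrix s L N x) \<and>
         min_eigenvalue (discrepancy_matrix s L N x) \<ge> sobolev_coeff s L / (32 * pi) \<and>
         condition_number (discrepancy_matrix s L N x)
           \<le> 32 * pi\<^sup>2 / q\<^sup>2 * ((\<Sum>l = 1..L. (2 * real l + 1) * sobolev_coeff s l) / sobolev_coeff s L)"
proof -
  define A where "A = discrepancy_matrix s L N x"
  define K where "K i j = trunc_kernel s L (x i) (x j)" for i j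
  \<comment> \<open>By \<open>geodesic_le_dist\<close>, geodesic separation \<open>q\<close> gives
    Euclidean separation at least \<open>2 * r\<close>; \<open>q \<le> pi\<close> gives
    \<open>r \<le> 1\<close>.\<close>
  define r where "r = q / pi"
  define a where "a = sobolev_coeff s L"
  define \<Sigma> where "\<Sigma> = (\<Sum>l = 1..L. (2 * real l + 1) * sobolev_coeff s l)"
  have sph: "norm (x i) = 1" if "i < N" for i using assms(2)[OF that] by simp
  have q: "0 < q" "q \<le> pi"
    and q_le: "\<And>i j. i < N \<Longrightarrow> j < N \<Longrightarrow> i \<noteq> j \<Longrightarrow> q \<le> geodesic_dist (x i) (x j)"
    unfolding assms(5) using separation_dist_props[of N x] assms(1,3) sph by auto
  have r: "0 < r" "r \<le> 1" using q(1,2) by (auto simp: r_def)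
  have sep: "2 * r \<le> dist (x i) (x j)" if "i < N" "j < N" "i \<noteq> j" for i j
  proof -
    have "2 * r \<le> 2 * (geodesic_dist (x i) (x j) / pi)"
      unfolding r_def using q_le[OF that] by (intro mult_left_mono divide_right_mono) auto
    also have "\<dots> \<le> dist (x i) (x j)" by (rule geodesic_le_dist) (auto simp: sph that)
    finally show ?thesis .
  qed
  have a: "a > 0" by (simp add: a_def sobolev_coeff_pos)
  have N8: "real N \<le> 8 / r\<^sup>2" using card_on_sphere[of "{..<N}" r x] sep r sph by simp
  \<comment> \<open>The largest \<open>n\<close> for which the degree bound
    \<open>2 * (n - 1)\<close> of the squared Fejer kernel stays within \<open>L\<close>.\<close>
  define n where "n = L div 2 + 1"
  have "55 / q \<le> real L" unfolding assms(6) by (rule real_nat_ceiling_ge)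
  moreover have "L + 1 \<le> 2 * n" unfolding n_def by presburger
  then have "real L + 1 \<le> 2 * real n" by linarith
  ultimately have "55 / q \<le> 2 * real n" by linarith
  then have "55 \<le> 2 * (real n * q)" using q(1) by (simp add: field_simps)
  moreover have "16 * pi \<le> 55" using pi_approx by simp
  ultimately have "8 * pi \<le> real n * q" by linarith
  then have nr: "8 \<le> real n * r" by (simp add: r_def field_simps)
  define lo where "lo = a * (8 / r\<^sup>2) / (4 * pi)"
  define hi where "hi = real N * \<Sigma> / (4 * pi)"
  have lower: "lo * (\<Sum>i<N. (v i)\<^sup>2) \<le> (\<Sum>i<N. \<Sum>j<N. v i * v j * K i j)" for v
  proof -
    define Q where "Q l = (\<Sum>i<N. \<Sum>j<N. v i * v j * poly (legendre l) (inner (x i) (x j)))" for l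
    have "Q l \<ge> 0" for l
      unfolding Q_def by (intro legendre_psd) (auto simp: norm_eq_1[symmetric] sph)
    \<comment> \<open>Every weight up to \<open>L\<close> is at least the last one, and the forms
      \<open>Q l\<close> are nonnegative, so all weights may be lowered to \<open>a\<close>.\<close>
    then have "(\<Sum>l = 1..L. a * (real (2 * l + 1) * Q l)) \<le> (\<Sum>l = 1..L. sobolev_coeff s l * (real (2 * l + 1) * Q l))"
      unfolding a_def by (intro sum_mono mult_right_mono sobolev_coeff_antimono assms) auto
    moreover have "a * (8 / r\<^sup>2 * (\<Sum>i<N. (v i)\<^sup>2)) \<le> a * (\<Sum>l = 1..L. real (2 * l + 1) * Q l)"
      unfolding Q_def using a
      by (intro mult_left_mono unweighted_form_bound[where n = n] sph sep r nr) (auto simp: n_def)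
    ultimately have "a * (8 / r\<^sup>2 * (\<Sum>i<N. (v i)\<^sup>2)) \<le> (\<Sum>l = 1..L. sobolev_coeff s l * (real (2 * l + 1) * Q l))"
      by (simp only: sum_distrib_left)
    then have "a * (8 / r\<^sup>2 * (\<Sum>i<N. (v i)\<^sup>2)) / (4 * pi) \<le> (\<Sum>l = 1..L. sobolev_coeff s l * (real (2 * l + 1) * Q l)) / (4 * pi)"
      by (intro divide_right_mono) auto
    then show ?thesis unfolding K_def trunc_kernel_form lo_def Q_def by (simp add: mult_ac)
  qed
  have upper: "(\<Sum>i<N. \<Sum>j<N. v i * v j * K i j) \<le> hi * (\<Sum>i<N. (v i)\<^sup>2)" for v
    unfolding K_def hi_def \<Sigma>_def by (rule trunc_kernel_upper) (rule sph)
  have lo: "lo > 0" using a r by (simp add: lo_def)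
  have A_eq: "A = mat N N (\<lambda>(i, j). K i j)" by (simp add: A_def discrepancy_matrix_def K_def)
  have A: "A \<in> carrier_mat N N" by (simp add: A_eq)
  have sym: "K i j = K j i" for i j by (simp add: K_def trunc_kernel_def inner_commute)
  have fin: "finite (spectrum A)" using card_finite_spectrum(1)[OF A] .
  have ne: "spectrum A \<noteq> {}"
    using assms(1) sym by (intro real_symmetric_spectrum_nonempty[OF A]) (auto simp: A_eq)
  have bounds: "lo \<le> k" "k \<le> hi" if "k \<in> spectrum A" for k
    using spectrum_bounds[OF lower upper, of k] that by (auto simp: A_eq)
  have mn: "lo \<le> min_eigenvalue A" unfolding min_eigenvalue_def using fin ne bounds by simp
  have mx: "max_eigenvalue A \<le> hi" unfolding max_eigenvalue_def using fin ne bounds by simp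
  have spd: "sym_pos_def A"
    unfolding sym_pos_def_def
  proof (intro conjI ballI impI)
    show "square_mat A" using A by simp
    show "transpose_mat A = A" by (rule eq_matI) (auto simp: A_eq sym)
    fix v :: "real Matrix.vec" assume v: "v \<in> carrier_vec (dim_row A)" "v \<noteq> 0\<^sub>v (dim_row A)"
    then have v': "v \<in> carrier_vec N" "v \<noteq> 0\<^sub>v N" using A by auto
    have "0 < (\<Sum>i<N. (vec_index v i)\<^sup>2)" using sum_norm_vec_pos[OF v'] by simp
    then have "0 < lo * (\<Sum>i<N. (vec_index v i)\<^sup>2)" using lo by simp
    also have "\<dots> \<le> scalar_prod v (A *\<^sub>v v)"
      unfolding A_eq quadratic_form_mat[OF v'(1)] by (rule lower)
    finally show "0 < scalar_prod v (A *\<^sub>v v)" .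
  qed
  have r2: "1 \<le> 1 / r\<^sup>2" using r by (simp add: power_le_one)
  have "a / (32 * pi) \<le> lo"
  proof -
    have "a / (32 * pi) = a * (1 / 8) / (4 * pi)" by simp
    also have "\<dots> \<le> lo" unfolding lo_def using a r2 by (intro divide_right_mono mult_left_mono) auto
    finally show ?thesis .
  qed
  with mn have min_bound: "a / (32 * pi) \<le> min_eigenvalue A" by simp
  have \<Sigma>: "\<Sigma> \<ge> 0"
    unfolding \<Sigma>_def by (intro sum_nonneg mult_nonneg_nonneg less_imp_le[OF sobolev_coeff_pos]) auto
  have "condition_number A \<le> hi / lo"
    unfolding condition_number_def using mn mx lo \<Sigma>
    by (intro frac_le) (auto simp: hi_def)
  also have "\<dots> = real N / (8 / r\<^sup>2) * (\<Sigma> / a)" by (simp add: hi_def lo_def)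
  \<comment> \<open>The factor \<open>8 / r^2\<close> in \<open>lo\<close> already outweighs
    \<open>N\<close>, so the quotient is at most 1, while \<open>32 / r^2\<close> is at least
    32.\<close>
  also have "\<dots> \<le> (32 / r\<^sup>2) * (\<Sigma> / a)"
  proof (intro mult_right_mono)
    have "real N / (8 / r\<^sup>2) \<le> 1" using N8 r by (subst divide_le_eq_1_pos) auto
    then show "real N / (8 / r\<^sup>2) \<le> 32 / r\<^sup>2" using r2 by linarith
  qed (use a \<Sigma> in auto)
  also have "32 / r\<^sup>2 = 32 * pi\<^sup>2 / q\<^sup>2" by (simp add: r_def power_divide)
  finally show ?thesis
    using spd min_bound unfolding A_def \<Sigma>_def a_def by blast
qed

end
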